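(* Let $X$ be a finite simple connected graph with adjacency matrix $A$. Let $u$ be a spectrally extremal vertex and $v$ a vertex with $d(u,v) = \varepsilon_u$. Write $\Phi_u = \{\theta_0,\dots,\theta_{d^*}\}$ with $\theta_r > \theta_{r+1}$ for all $r$, and suppose there are integers $a$, $\Delta$ and $b_0,\dots,b_{d^*}$ with $\theta_r = \frac{a + b_r\sqrt{\Delta}}{2}$ for all $r$. Then $X$ admits perfect state transfer between $u$ and $v$ if and only if the following hold: (i) $u$ and $v$ are antipodal; (ii) there is an integer $\alpha$ such that for every odd $r$, the exponent of $2$ in the prime factorization of $b_0 - b_r$ equals $\alpha$; (iii) for every even $r \ge 2$, the exponent of $2$ in the prime factorization of $b_0 - b_r$ is larger than $\alpha$. If these conditions hold, perfect state transfer between $u$ and $v$ occurs at time $\frac{2\pi}{2^\alpha\sqrt{\Delta}}$ (and at any odd multiple of it).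
   Context: $A = \sum_\theta \theta E_\theta$ is the spectral decomposition of $A$ over its distinct eigenvalues ($E_\theta$ the orthogonal projection onto the $\theta$-eigenspace); $e_w$ is the standard basis vector of $w$. Eigenvalue support $\Phi_u = \{\theta : E_\theta e_u \ne 0\}$; dual degree $d^* = d^*(u) = |\Phi_u|-1$; eccentricity $\varepsilon_u = \max_w d(u,w)$; $u$ is spectrally extremal if $\varepsilon_u = d^*(u)$. $X$ admits perfect state transfer between $u$ and $v$ at time $\tau$ if $|e_v^T \exp(\mathrm{i}\tau A) e_u| = 1$. Vertices $u,v$ are cospectral if $X\setminus u$ and $X\setminus v$ have the same adjacency spectrum. Let $\varphi$ be the positive eigenvector of $A$ for its largest eigenvalue and $D = \mathrm{diag}(\varphi)$. A partition of $V(X)$ is pseudo equitable if for each class $C$ and vertex $x$, $\sum_{y\in C}(D^{-1}AD)_{x,y}$ depends only on the class containing $x$. The distance partition of $u$ is the partition into the sets $\{w : d(u,w)=i\}$. Vertices $u$ and $v$ are antipodal if: there is a pseudo equitable partition that is simultaneously the distance partition of $u$ and of $v$; $\{u\}$ and $\{v\}$ are singleton classes of this partition at maximum distance from each other; and $u$ and $v$ are cospectral. *)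

theory Defs
  imports "HOL-Analysis.Analysis" "HOL-Combinatorics.Combinatorics"
    "HOL-Computational_Algebra.Computational_Algebra"
begin

definition simple_graph :: "('v::finite \<Rightarrow> 'v \<Rightarrow> bool) \<Rightarrow> bool" where
  "simple_graph E \<longleftrightarrow> (\<forall>x y. E x y \<longrightarrow> E y x) \<and> (\<forall>x. \<not> E x x)"

definition walk_len :: "('v \<Rightarrow> 'v \<Rightarrow> bool) \<Rightarrow> nat \<Rightarrow> 'v \<Rightarrow> 'v \<Rightarrow> bool" where
  "walk_len E n x y \<longleftrightarrow> (x, y) \<in> {(a, b). E a b} ^^ n"

definition connected_graph :: "('v::finite \<Rightarrow> 'v \<Rightarrow> bool) \<Rightarrow> bool" where
  "connected_graph E \<longleftrightarrow> (\<forall>x y. \<exists>n. walk_len E n x y)"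

definition gdist :: "('v \<Rightarrow> 'v \<Rightarrow> bool) \<Rightarrow> 'v \<Rightarrow> 'v \<Rightarrow> nat" where
  "gdist E x y = (LEAST n. walk_len E n x y)"

definition ecc :: "('v::finite \<Rightarrow> 'v \<Rightarrow> bool) \<Rightarrow> 'v \<Rightarrow> nat" where
  "ecc E u = Max (range (gdist E u))"

definition adj_matrix :: "('v::finite \<Rightarrow> 'v \<Rightarrow> bool) \<Rightarrow> real ^ 'v ^ 'v" where
  "adj_matrix E = (\<chi> i j. if E i j then 1 else 0)"

fun matpow :: "real ^ 'n ^ 'n \<Rightarrow> nat \<Rightarrow> real ^ 'n ^ 'n" where
  "matpow M 0 = mat 1"
| "matpow M (Suc k) = M ** matpow M k"

definition eigenspace :: "real ^ 'n ^ 'n \<Rightarrow> real \<Rightarrow> (real ^ 'n) set" where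
  "eigenspace M \<theta> = {x. M *v x = \<theta> *\<^sub>R x}"

definition eigenvalues :: "real ^ 'n ^ 'n \<Rightarrow> real set" where
  "eigenvalues M = {\<theta>. \<exists>x. x \<noteq> 0 \<and> M *v x = \<theta> *\<^sub>R x}"

text \<open>E_theta: the orthogonal projection onto the theta-eigenspace
  (the unique symmetric idempotent matrix whose column space is the eigenspace)\<close>
definition eig_proj :: "real ^ 'n ^ 'n \<Rightarrow> real \<Rightarrow> real ^ 'n ^ 'n" where
  "eig_proj M \<theta> = (THE P. transpose P = P \<and> P ** P = P \<and>
                         range (\<lambda>x. P *v x) = eigenspace M \<theta>)"

definition basis_vec :: "'n::finite \<Rightarrow> real ^ 'n" where
  "basis_vec w = axis w 1"

definition eig_support :: "('v::finite \<Rightarrow> 'v \<Rightarrow> bool) \<Rightarrow> 'v \<Rightarrow> real set" where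
  "eig_support E u = {\<theta> \<in> eigenvalues (adj_matrix E).
       eig_proj (adj_matrix E) \<theta> *v basis_vec u \<noteq> 0}"

definition dual_degree :: "('v::finite \<Rightarrow> 'v \<Rightarrow> bool) \<Rightarrow> 'v \<Rightarrow> nat" where
  "dual_degree E u = card (eig_support E u) - 1"

definition spectrally_extremal :: "('v::finite \<Rightarrow> 'v \<Rightarrow> bool) \<Rightarrow> 'v \<Rightarrow> bool" where
  "spectrally_extremal E u \<longleftrightarrow> ecc E u = dual_degree E u"

definition supp_eig :: "('v::finite \<Rightarrow> 'v \<Rightarrow> bool) \<Rightarrow> 'v \<Rightarrow> nat \<Rightarrow> real" where
  "supp_eig E u r = rev (sorted_list_of_set (eig_support E u)) ! r"

definition exp_iA_entry ::
  "('v::finite \<Rightarrow> 'v \<Rightarrow> bool) \<Rightarrow> real \<Rightarrow> 'v \<Rightarrow> 'v \<Rightarrow> complex" where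
  "exp_iA_entry E \<tau> w x =
     (\<Sum>k. (\<i> * complex_of_real \<tau>) ^ k / of_nat (fact k) *
           complex_of_real (matpow (adj_matrix E) k $ w $ x))"

definition pst_at :: "('v::finite \<Rightarrow> 'v \<Rightarrow> bool) \<Rightarrow> 'v \<Rightarrow> 'v \<Rightarrow> real \<Rightarrow> bool" where
  "pst_at E u v \<tau> \<longleftrightarrow> cmod (exp_iA_entry E \<tau> v u) = 1"

definition admits_pst :: "('v::finite \<Rightarrow> 'v \<Rightarrow> bool) \<Rightarrow> 'v \<Rightarrow> 'v \<Rightarrow> bool" where
  "admits_pst E u v \<longleftrightarrow> (\<exists>\<tau>. pst_at E u v \<tau>)"

definition det_on :: "'a set \<Rightarrow> ('a \<Rightarrow> 'a \<Rightarrow> real) \<Rightarrow> real" where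
  "det_on S M = (\<Sum>p | p permutes S. of_int (sign p) * (\<Prod>i\<in>S. M i (p i)))"

definition charpoly_deleted :: "('v::finite \<Rightarrow> 'v \<Rightarrow> bool) \<Rightarrow> 'v \<Rightarrow> real \<Rightarrow> real" where
  "charpoly_deleted E w t = det_on (UNIV - {w})
     (\<lambda>i j. (if i = j then t else 0) - (if E i j then 1 else 0))"

definition cospectral_vertices :: "('v::finite \<Rightarrow> 'v \<Rightarrow> bool) \<Rightarrow> 'v \<Rightarrow> 'v \<Rightarrow> bool" where
  "cospectral_vertices E u v \<longleftrightarrow> (\<forall>t. charpoly_deleted E u t = charpoly_deleted E v t)"

definition perron_vec :: "('v::finite \<Rightarrow> 'v \<Rightarrow> bool) \<Rightarrow> real ^ 'v" where
  "perron_vec E = (SOME \<phi>. (\<forall>i. \<phi> $ i > 0) \<and>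
       adj_matrix E *v \<phi> = Max (eigenvalues (adj_matrix E)) *\<^sub>R \<phi>)"

definition is_partition :: "'v set set \<Rightarrow> bool" where
  "is_partition P \<longleftrightarrow> \<Union>P = UNIV \<and> {} \<notin> P \<and> (\<forall>C\<in>P. \<forall>C'\<in>P. C \<noteq> C' \<longrightarrow> C \<inter> C' = {})"

text \<open>pseudo equitable: sum over y in C of (D^-1 A D)_{x,y} depends only on the
  class containing x\<close>
definition pseudo_equitable :: "('v::finite \<Rightarrow> 'v \<Rightarrow> bool) \<Rightarrow> 'v set set \<Rightarrow> bool" where
  "pseudo_equitable E P \<longleftrightarrow> is_partition P \<and>
     (let \<phi> = perron_vec E;
          B = (\<lambda>x y. adj_matrix E $ x $ y * \<phi> $ y / \<phi> $ x)
      in \<forall>C\<in>P. \<forall>C'\<in>P. \<forall>x\<in>C'. \<forall>x'\<in>C'. (\<Sum>y\<in>C. B x y) = (\<Sum>y\<in>C. B x' y))"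

definition distance_partition :: "('v::finite \<Rightarrow> 'v \<Rightarrow> bool) \<Rightarrow> 'v \<Rightarrow> 'v set set" where
  "distance_partition E u = {{w. gdist E u w = i} | i. i \<le> ecc E u}"

definition antipodal :: "('v::finite \<Rightarrow> 'v \<Rightarrow> bool) \<Rightarrow> 'v \<Rightarrow> 'v \<Rightarrow> bool" where
  "antipodal E u v \<longleftrightarrow>
     (\<exists>P. pseudo_equitable E P \<and> P = distance_partition E u \<and> P = distance_partition E v
          \<and> {u} \<in> P \<and> {v} \<in> P
          \<and> gdist E u v = Max {gdist E u w | w. True})
     \<and> cospectral_vertices E u v"

end

theory Submission
  imports Defs
begin

text \<open>Since \<open>(A\<^sup>k)\<^sub>v\<^sub>u\<close> vanishes for \<open>k < d\<close> and is positive for \<open>k = d\<close>, where \<open>d = d\<^sup>*(u) = d(u, v)\<close>,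
  interpolation on the \<open>d + 1\<close> points of the eigenvalue support shows that the entry of the
  \<open>r\<close>-th projection at \<open>(v, u)\<close> has sign \<open>(-1)\<^sup>r\<close>. Equality in the Cauchy-Schwarz inequality then
  turns perfect state transfer at time \<open>\<tau>\<close> into two conditions: the \<open>r\<close>-th projections of \<open>e\<^sub>u\<close> and
  \<open>e\<^sub>v\<close> differ by the factor \<open>(-1)\<^sup>r\<close>, and \<open>exp(i\<tau>(\<theta>\<^sub>0 - \<theta>\<^sub>r)) = (-1)\<^sup>r\<close>. The second one is the
  statement about powers of two.

  The first one is antipodality. Let \<open>K\<close> be the \<open>(d + 1)\<close>-dimensional Krylov space of \<open>e\<^sub>u\<close>.
  If \<open>e\<^sub>u\<close> and \<open>e\<^sub>v\<close> have parallel projections, then, for each \<open>i\<close>, powers of \<open>A\<close> applied to both of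
  them split \<open>K\<close> into vectors supported near \<open>u\<close> and vectors supported near \<open>v\<close>. Applied to the
  positive Perron vector this shows that the distance partitions of \<open>u\<close> and \<open>v\<close> agree and that
  the restrictions of the Perron vector to their classes form a basis of the \<open>A\<close>-invariant space
  \<open>K\<close>, which is pseudo equitability. Conversely, pseudo equitability puts \<open>e\<^sub>v\<close> into \<open>K\<close>, so the
  projections are parallel, and cospectrality makes them equal in norm.\<close>

no_notation fps_nth (infixl "$" 75)

section \<open>Spectral decomposition of symmetric matrices\<close>

context
  fixes M :: "real ^ 'n ^ 'n"
  assumes sym: "transpose M = M"
begin

lemma sym_inner: "(M *v x) \<bullet> y = x \<bullet> (M *v y)"
  by (metis dot_lmul_matrix sym transpose_matrix_vector)

text \<open>A nonnegative quadratic form vanishing at \<open>x\<close> has zero gradient there.\<close>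
lemma rayleigh_max_eigenvector:
  assumes S: "subspace S" and inv: "\<And>y. y \<in> S \<Longrightarrow> M *v y \<in> S"
    and le: "\<And>y. y \<in> S \<Longrightarrow> y \<bullet> (M *v y) \<le> \<rho> * (y \<bullet> y)"
    and x: "x \<in> S" and eq: "x \<bullet> (M *v x) = \<rho> * (x \<bullet> x)"
  shows "M *v x = \<rho> *\<^sub>R x"
proof -
  define z where "z = \<rho> *\<^sub>R x - M *v x"
  define q where "q = \<rho> * (z \<bullet> z) - z \<bullet> (M *v z)"
  define c where "c = z \<bullet> z"
  have z: "z \<in> S"
    unfolding z_def by (intro subspace_diff subspace_scale S x inv)
  have q: "q \<ge> 0"
    using le[OF z] by (simp add: q_def)
  have nonneg: "0 \<le> 2 * t * c + t\<^sup>2 * q" for t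
  proof -
    have "x + t *\<^sub>R z \<in> S"
      by (intro subspace_add subspace_scale S x z)
    from le[OF this] have "0 \<le> \<rho> * ((x + t *\<^sub>R z) \<bullet> (x + t *\<^sub>R z)) - (x + t *\<^sub>R z) \<bullet> (M *v (x + t *\<^sub>R z))"
      by simp
    also have "\<dots> = (\<rho> * (x \<bullet> x) - x \<bullet> (M *v x)) + 2 * t * (\<rho> * (x \<bullet> z) - (M *v x) \<bullet> z) + t\<^sup>2 * q"
      using sym_inner[of x z]
      by (simp add: q_def matrix_vector_right_distrib matrix_vector_mult_scaleR inner_left_distrib
          inner_right_distrib power2_eq_square algebra_simps inner_commute)
    also have "\<rho> * (x \<bullet> z) - (M *v x) \<bullet> z = c"
      by (simp add: c_def z_def inner_diff_left)
    finally show ?thesis using eq by simp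
  qed
  have "c = 0"
  proof (rule ccontr)
    assume "c \<noteq> 0"
    \<comment> \<open>At \<open>t = - s\<close> the form equals
      \<open>- (s\<^sup>2 * (q + 2))\<close>; dividing by \<open>q + 1\<close> instead of
      \<open>q\<close> also covers \<open>q = 0\<close>.\<close>
    define s where "s = c / (q + 1)"
    have c: "c = s * (q + 1)" and "s \<noteq> 0"
      using q \<open>c \<noteq> 0\<close> by (simp_all add: s_def)
    have "0 \<le> - (s\<^sup>2 * (q + 2))"
      using nonneg[of "- s"] by (simp add: c power2_eq_square algebra_simps)
    moreover have "0 < s\<^sup>2 * (q + 2)"
      using q \<open>s \<noteq> 0\<close> by simp
    ultimately show False by simp
  qed
  then show ?thesis by (simp add: c_def z_def)
qed

text \<open>The quadratic form attains its maximum on the compact unit sphere of \<open>S\<close>,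
  and homogeneity extends the bound to all of \<open>S\<close>. The bound is part of the conclusion
  because it later identifies \<rho> as the largest eigenvalue.\<close>

lemma rayleigh_max_exists:
  assumes S: "subspace S" and inv: "\<And>y. y \<in> S \<Longrightarrow> M *v y \<in> S" and ne: "\<exists>y\<in>S. y \<noteq> 0"
  obtains x \<rho> where "x \<in> S" "x \<noteq> 0" "M *v x = \<rho> *\<^sub>R x"
    "\<And>y. y \<in> S \<Longrightarrow> y \<bullet> (M *v y) \<le> \<rho> * (y \<bullet> y)"
proof -
  let ?K = "S \<inter> sphere 0 1"
  have norm1: "y /\<^sub>R norm y \<in> ?K" if "y \<in> S" "y \<noteq> 0" for y
    using that S by (auto simp: subspace_scale)
  have "compact ?K"
    by (intro closed_Int_compact closed_subspace S) auto
  moreover have "?K \<noteq> {}"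
    using ne norm1 by blast
  moreover have "continuous_on ?K (\<lambda>y. y \<bullet> (M *v y))"
    by (intro continuous_intros linear_continuous_on linear_linear[THEN iffD2]) simp
  ultimately obtain x where x: "x \<in> ?K" and max: "\<And>y. y \<in> ?K \<Longrightarrow> y \<bullet> (M *v y) \<le> x \<bullet> (M *v x)"
    using continuous_attains_sup[of ?K "\<lambda>y. y \<bullet> (M *v y)"] by blast
  define \<rho> where "\<rho> = x \<bullet> (M *v x)"
  have xx: "x \<bullet> x = 1"
    using x by (simp add: norm_eq_1)
  have le: "y \<bullet> (M *v y) \<le> \<rho> * (y \<bullet> y)" if "y \<in> S" for y
  proof (cases "y = 0")
    case False
    have "(y /\<^sub>R norm y) \<bullet> (M *v (y /\<^sub>R norm y)) \<le> \<rho>"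
      unfolding \<rho>_def by (intro max norm1 that False)
    then have "(y \<bullet> (M *v y)) / (norm y)\<^sup>2 \<le> \<rho>"
      by (simp add: matrix_vector_mult_scaleR power2_eq_square field_simps)
    then show ?thesis
      using False by (simp add: pos_divide_le_eq dot_square_norm)
  qed simp
  have "M *v x = \<rho> *\<^sub>R x"
    by (rule rayleigh_max_eigenvector[OF S inv le]) (use x xx in \<open>auto simp: \<rho>_def\<close>)
  with x xx le that[of x \<rho>] show thesis by force
qed

section \<open>Eigenspaces and their orthogonal projections\<close>

lemma subspace_eigenspace: "subspace (eigenspace M \<theta>)"
  by (auto simp: subspace_def eigenspace_def matrix_vector_right_distrib matrix_vector_mult_scaleR
      scaleR_add_right)

lemma eigenspace_orthogonal:
  assumes "x \<in> eigenspace M \<theta>" "y \<in> eigenspace M \<mu>" "\<theta> \<noteq> \<mu>"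
  shows "x \<bullet> y = 0"
  using sym_inner[of x y] assms by (auto simp: eigenspace_def)

text \<open>The orthogonal complement of all eigenspaces is invariant by symmetry; if it were
  nonzero, it would contain an eigenvector, which would be orthogonal to itself.\<close>

lemma span_eigenspaces: "span (\<Union>\<theta>. eigenspace M \<theta>) = UNIV"
proof (rule ccontr)
  let ?U = "\<Union>\<theta>. eigenspace M \<theta>"
  define S where "S = {x. \<forall>y\<in>?U. x \<bullet> y = 0}"
  assume "span ?U \<noteq> UNIV"
  then have "span ?U \<subset> span UNIV" by auto
  then obtain x where "x \<noteq> 0" "\<And>y. y \<in> span ?U \<Longrightarrow> orthogonal x y"
    by (rule orthogonal_to_subspace_exists_gen) blast
  then have "x \<in> S" by (auto simp: S_def orthogonal_def intro: span_base)
  have "subspace S"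
    by (auto simp: S_def subspace_def inner_left_distrib)
  moreover have "M *v y \<in> S" if "y \<in> S" for y
    using that by (auto simp: S_def sym_inner eigenspace_def)
  ultimately obtain z \<rho> where "z \<in> S" "z \<noteq> 0" "M *v z = \<rho> *\<^sub>R z"
    using rayleigh_max_exists[of S] \<open>x \<in> S\<close> \<open>x \<noteq> 0\<close> by metis
  then show False
    by (force simp: S_def eigenspace_def)
qed

text \<open>The definite description in \<open>eig_proj\<close> calls for existence and uniqueness.
  An orthonormal basis of the eigenspace gives existence; two such projections satisfy
  \<open>P ** Q = Q\<close> and \<open>Q ** P = P\<close>, and transposing one of these identities
  yields \<open>P = Q\<close>.\<close>

lemma eig_proj_props:
  shows eig_proj_transpose: "transpose (eig_proj M \<theta>) = eig_proj M \<theta>" (is ?A)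
    and eig_proj_idem: "eig_proj M \<theta> ** eig_proj M \<theta> = eig_proj M \<theta>" (is ?B)
    and eig_proj_range: "range (\<lambda>x. eig_proj M \<theta> *v x) = eigenspace M \<theta>" (is ?C)
proof -
  let ?is = "\<lambda>P :: real^'n^'n. transpose P = P \<and> P ** P = P \<and> range (\<lambda>x. P *v x) = eigenspace M \<theta>"
  obtain B where B: "B \<subseteq> eigenspace M \<theta>" "pairwise orthogonal B" "\<And>x. x \<in> B \<Longrightarrow> norm x = 1"
    "independent B" "span B = eigenspace M \<theta>"
    using orthonormal_basis_subspace[OF subspace_eigenspace] by metis
  have fin: "finite B"
    using B(4) by (rule independent_imp_finite)
  define f where "f x = (\<Sum>c\<in>B. (c \<bullet> x) *\<^sub>R c)" for x
  have lin: "linear f"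
    by (auto simp: f_def linear_iff inner_right_distrib scaleR_add_left sum.distrib scaleR_sum_right)
  have P: "matrix f *v x = f x" for x
    by (simp add: lin)
  have f_id: "f x = x" if "x \<in> span B" for x
  proof (rule linear_eq_on[OF lin linear_ident that])
    fix c assume c: "c \<in> B"
    have "f c = (\<Sum>c'\<in>B. if c' = c then c else 0)"
      unfolding f_def
    proof (rule sum.cong[OF refl])
      fix c' assume "c' \<in> B"
      then show "(c' \<bullet> c) *\<^sub>R c' = (if c' = c then c else 0)"
        using B(2,3) c by (auto simp: pairwise_def orthogonal_def norm_eq_1)
    qed
    then show "f c = c" using fin c by simp
  qed
  have f_span: "f x \<in> span B" for x
    unfolding f_def by (intro span_sum span_scale span_base)
  have f_sym: "f x \<bullet> y = x \<bullet> f y" for x y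
    by (simp add: f_def inner_sum_left inner_sum_right inner_commute mult.commute)
  have "?is (matrix f)"
  proof (intro conjI)
    have "(transpose (matrix f) *v x) \<bullet> y = (matrix f *v x) \<bullet> y" for x y
      by (metis P dot_lmul_matrix f_sym transpose_matrix_vector)
    then show "transpose (matrix f) = matrix f"
      by (metis matrix_eq vector_eq_rdot)
    show "matrix f ** matrix f = matrix f"
      by (simp add: matrix_eq P f_id f_span flip: matrix_vector_mul_assoc)
    show "range (\<lambda>x. matrix f *v x) = eigenspace M \<theta>"
      using f_id f_span unfolding P B(5) by (metis (no_types, lifting) image_subset_iff subsetI subset_antisym rangeI)
  qed
  moreover have "P = Q" if P: "?is P" and Q: "?is Q" for P Q
  proof -
    have "P' ** Q' = Q'" if "?is P'" "?is Q'" for P' Q'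
    proof -
      have "P' *v (Q' *v x) = Q' *v x" for x
      proof -
        have "Q' *v x \<in> range (\<lambda>x. P' *v x)"
          using that by auto
        then show ?thesis
          using that by (metis (no_types, lifting) imageE matrix_vector_mul_assoc)
      qed
      then show ?thesis by (simp add: matrix_eq flip: matrix_vector_mul_assoc)
    qed
    from this[OF P Q] this[OF Q P] show ?thesis
      by (metis P Q matrix_transpose_mul)
  qed
  ultimately have "\<exists>!P. ?is P" by blast
  from theI'[OF this] have "?is (eig_proj M \<theta>)"
    by (simp only: eig_proj_def)
  then show ?A ?B ?C by auto
qed

lemma eig_proj_eigenspace: "eig_proj M \<theta> *v x \<in> eigenspace M \<theta>"
  using eig_proj_range by auto

lemma eig_proj_eigen: "M *v (eig_proj M \<theta> *v x) = \<theta> *\<^sub>R (eig_proj M \<theta> *v x)"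
  using eig_proj_eigenspace by (auto simp: eigenspace_def)

lemma eig_proj_id:
  assumes "x \<in> eigenspace M \<theta>"
  shows "eig_proj M \<theta> *v x = x"
proof -
  from assms obtain y where "x = eig_proj M \<theta> *v y"
    unfolding eig_proj_range[of \<theta>, symmetric] by blast
  then show ?thesis
    by (simp add: matrix_vector_mul_assoc eig_proj_idem)
qed

lemma eig_proj_inner: "(eig_proj M \<theta> *v x) \<bullet> y = x \<bullet> (eig_proj M \<theta> *v y)"
  by (metis dot_lmul_matrix eig_proj_transpose transpose_matrix_vector)

lemma eig_proj_inner': "(eig_proj M \<theta> *v x) \<bullet> y = (eig_proj M \<theta> *v x) \<bullet> (eig_proj M \<theta> *v y)"
  by (metis eig_proj_eigenspace eig_proj_id eig_proj_inner)

lemma eig_proj_orthogonal: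
  "\<theta> \<noteq> \<mu> \<Longrightarrow> (eig_proj M \<theta> *v x) \<bullet> (eig_proj M \<mu> *v y) = 0"
  by (rule eigenspace_orthogonal) (auto intro: eig_proj_eigenspace)

lemma eig_proj_zero:
  assumes "x \<in> eigenspace M \<theta>" "\<theta> \<noteq> \<mu>"
  shows "eig_proj M \<mu> *v x = 0"
  by (metis assms eig_proj_id eig_proj_inner eig_proj_orthogonal inner_eq_zero_iff)

lemma eigenvalues_iff: "\<theta> \<in> eigenvalues M \<longleftrightarrow> (\<exists>x\<in>eigenspace M \<theta>. x \<noteq> 0)"
  by (auto simp: eigenvalues_def eigenspace_def)

lemma eig_proj_nonzero_eigenvalue: "eig_proj M \<theta> *v x \<noteq> 0 \<Longrightarrow> \<theta> \<in> eigenvalues M"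
  using eig_proj_eigenspace eigenvalues_iff by blast

lemma finite_eigenvalues: "finite (eigenvalues M)"
proof -
  have "\<forall>\<theta>\<in>eigenvalues M. \<exists>x\<in>eigenspace M \<theta>. x \<noteq> 0"
    using eigenvalues_iff by auto
  then obtain x where x: "\<And>\<theta>. \<theta> \<in> eigenvalues M \<Longrightarrow> x \<theta> \<in> eigenspace M \<theta> \<and> x \<theta> \<noteq> 0"
    by metis
  have "inj_on x (eigenvalues M)"
    by (intro inj_onI) (metis eigenspace_orthogonal inner_eq_zero_iff x)
  moreover have "independent (x ` eigenvalues M)"
    by (rule pairwise_orthogonal_independent)
      (use x eigenspace_orthogonal in \<open>auto simp: pairwise_def orthogonal_def, metis\<close>)
  then have "finite (x ` eigenvalues M)"
    by (rule independent_imp_finite)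
  ultimately show ?thesis using finite_imageD by blast
qed

text \<open>Both sides are linear in \<open>x\<close>, so comparing them on eigenvectors
  suffices.\<close>

lemma sum_eig_proj: "(\<Sum>\<theta>\<in>eigenvalues M. eig_proj M \<theta> *v x) = x"
proof (rule linear_eq_on)
  show "linear (\<lambda>x. \<Sum>\<theta>\<in>eigenvalues M. eig_proj M \<theta> *v x)"
    by (auto simp: linear_iff matrix_vector_right_distrib matrix_vector_mult_scaleR sum.distrib scaleR_sum_right)
  show "linear (\<lambda>x :: real^'n. x)" by (rule linear_ident)
  show "x \<in> span (\<Union>\<theta>. eigenspace M \<theta>)" by (simp add: span_eigenspaces)
next
  fix y assume "y \<in> (\<Union>\<theta>. eigenspace M \<theta>)"
  then obtain \<mu> where \<mu>: "y \<in> eigenspace M \<mu>" by auto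
  show "(\<Sum>\<theta>\<in>eigenvalues M. eig_proj M \<theta> *v y) = y"
  proof (cases "y = 0")
    case False
    then have ev: "\<mu> \<in> eigenvalues M" using \<mu> eigenvalues_iff by auto
    have "(\<Sum>\<theta>\<in>eigenvalues M. eig_proj M \<theta> *v y) = (\<Sum>\<theta>\<in>eigenvalues M. if \<theta> = \<mu> then y else 0)"
      by (rule sum.cong) (use \<mu> eig_proj_id eig_proj_zero in auto)
    then show ?thesis using finite_eigenvalues ev by simp
  qed simp
qed

lemma inner_eig_proj: "x \<bullet> y = (\<Sum>\<theta>\<in>eigenvalues M. (eig_proj M \<theta> *v x) \<bullet> (eig_proj M \<theta> *v y))"
  by (subst (1) sum_eig_proj[of x, symmetric]) (simp add: inner_sum_left eig_proj_inner'[of _ x y])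

lemma matpow_eigen:
  assumes "x \<in> eigenspace M \<theta>"
  shows "matpow M k *v x = \<theta> ^ k *\<^sub>R x"
proof (induction k)
  case (Suc k)
  then show ?case
    using assms by (simp add: eigenspace_def matrix_vector_mult_scaleR flip: matrix_vector_mul_assoc)
qed simp

lemma matpow_spectral: "matpow M k *v x = (\<Sum>\<theta>\<in>eigenvalues M. \<theta> ^ k *\<^sub>R (eig_proj M \<theta> *v x))"
proof -
  have "matpow M k *v x = matpow M k *v (\<Sum>\<theta>\<in>eigenvalues M. eig_proj M \<theta> *v x)"
    by (simp only: sum_eig_proj)
  also have "\<dots> = (\<Sum>\<theta>\<in>eigenvalues M. matpow M k *v (eig_proj M \<theta> *v x))"
    by (rule linear_sum) (rule matrix_vector_mul_linear)
  finally show ?thesis by (simp add: matpow_eigen[OF eig_proj_eigenspace])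
qed

lemma matpow_spectral_inner:
  "y \<bullet> (matpow M k *v x) = (\<Sum>\<theta>\<in>eigenvalues M. \<theta> ^ k * ((eig_proj M \<theta> *v x) \<bullet> (eig_proj M \<theta> *v y)))"
  by (simp add: matpow_spectral inner_sum_right inner_commute[of y] eig_proj_inner'[of _ x y])

end

section \<open>Walks, distances and the Perron vector\<close>

locale conn_graph =
  fixes E :: "'v::finite \<Rightarrow> 'v \<Rightarrow> bool"
  assumes simple: "simple_graph E" and conn: "connected_graph E"
begin

abbreviation "A \<equiv> adj_matrix E"
abbreviation "P \<equiv> eig_proj A"
abbreviation "e \<equiv> (basis_vec :: 'v \<Rightarrow> _)"

lemma edge_sym: "E x y \<longleftrightarrow> E y x"
  using simple by (auto simp: simple_graph_def)

lemma A_sym: "transpose A = A"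
  using edge_sym by (auto simp: transpose_def adj_matrix_def vec_eq_iff)

lemma A_mult: "(A *v x) $ i = (\<Sum>j | E i j. x $ j)"
proof -
  have "(A *v x) $ i = (\<Sum>j\<in>UNIV. if E i j then x $ j else 0)"
    unfolding matrix_vector_mult_def by (auto simp: adj_matrix_def intro!: sum.cong)
  then show ?thesis by (simp add: sum.If_cases)
qed

lemma walk_0 [simp]: "walk_len E 0 x y \<longleftrightarrow> x = y"
  by (simp add: walk_len_def)

lemma walk_Suc: "walk_len E (Suc n) x y \<longleftrightarrow> (\<exists>z. E x z \<and> walk_len E n z y)"
  unfolding walk_len_def by (metis (mono_tags, lifting) case_prodD case_prodI mem_Collect_eq relpow_Suc_D2 relpow_Suc_I2)

lemma walk_add: "walk_len E (m + n) x y \<longleftrightarrow> (\<exists>z. walk_len E m x z \<and> walk_len E n z y)"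
  by (induction m arbitrary: x) (auto simp: walk_Suc)

lemma walk_sym: "walk_len E n x y \<longleftrightarrow> walk_len E n y x"
proof (induction n arbitrary: x)
  case (Suc n)
  have "walk_len E (Suc n) x y \<longleftrightarrow> (\<exists>z. walk_len E n y z \<and> walk_len E 1 z x)"
    unfolding walk_Suc Suc by (auto simp: walk_Suc edge_sym[of x])
  then show ?case by (metis Suc_eq_plus1 walk_add)
qed auto

lemma walk_exists: "\<exists>n. walk_len E n x y"
  using conn by (simp add: connected_graph_def)

lemma gdist_walk: "walk_len E (gdist E x y) x y"
  unfolding gdist_def using walk_exists by (rule LeastI_ex)

lemma gdist_le: "walk_len E n x y \<Longrightarrow> gdist E x y \<le> n"
  unfolding gdist_def by (rule Least_le)

lemma gdist_sym: "gdist E x y = gdist E y x"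
  by (simp add: gdist_def walk_sym[of _ x y])

lemma gdist_eq_0 [simp]: "gdist E x y = 0 \<longleftrightarrow> x = y"
proof
  assume "gdist E x y = 0"
  with gdist_walk[of x y] show "x = y" by simp
qed (use gdist_le[of 0 x y] in auto)

lemma gdist_self [simp]: "gdist E x x = 0"
  by simp

lemma gdist_triangle: "gdist E x z \<le> gdist E x y + gdist E y z"
  by (metis gdist_le gdist_walk walk_add)

text \<open>The vertex reached after \<open>j\<close> steps of a geodesic works; the triangle
  inequality prevents either half from being shorter.\<close>

lemma gdist_between:
  assumes "j \<le> gdist E x y"
  obtains w where "gdist E x w = j" "gdist E w y = gdist E x y - j"
proof -
  have "walk_len E (j + (gdist E x y - j)) x y"
    using assms gdist_walk by simp
  then obtain w where "walk_len E j x w" "walk_len E (gdist E x y - j) w y"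
    by (auto simp: walk_add)
  then have "gdist E x w \<le> j" "gdist E w y \<le> gdist E x y - j"
    by (auto intro: gdist_le)
  with gdist_triangle[of x y w] assms that[of w] show thesis by linarith
qed

lemma gdist_le_ecc: "gdist E x y \<le> ecc E x"
  unfolding ecc_def by (rule Max_ge) auto

section \<open>Walks and powers of the adjacency matrix\<close>

lemma matpow_nonneg: "matpow A k $ x $ y \<ge> 0"
proof (induction k arbitrary: x)
  case (Suc k)
  then show ?case
    by (auto simp: matrix_matrix_mult_def adj_matrix_def intro!: sum_nonneg)
qed (simp add: mat_def)

lemma matpow_pos_iff: "matpow A k $ x $ y > 0 \<longleftrightarrow> walk_len E k x y"
proof (induction k arbitrary: x)
  case (Suc k)
  have "matpow A (Suc k) $ x $ y = (\<Sum>z | E x z. matpow A k $ z $ y)"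
    by (simp add: matrix_matrix_mult_def adj_matrix_def if_distrib[of "\<lambda>t. t * _"] sum.If_cases cong: if_cong)
  also have "\<dots> > 0 \<longleftrightarrow> (\<exists>z\<in>{z. E x z}. matpow A k $ z $ y > 0)"
    by (metis (mono_tags, lifting) finite less_le matpow_nonneg sum_nonneg sum_nonneg_eq_0_iff)
  finally show ?case by (simp add: Suc walk_Suc)
qed (simp add: mat_def)

lemma matpow_less_gdist: "k < gdist E x y \<Longrightarrow> matpow A k $ x $ y = 0"
  by (metis gdist_le leD less_le matpow_nonneg matpow_pos_iff)

lemma matpow_gdist: "matpow A (gdist E x y) $ x $ y > 0"
  by (simp add: matpow_pos_iff gdist_walk)

abbreviation krylov :: "nat \<Rightarrow> 'v \<Rightarrow> real ^ 'v" where
  "krylov k x \<equiv> matpow A k *v e x"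

lemma krylov_nth: "krylov k x $ w = matpow A k $ w $ x"
  by (simp add: basis_vec_def matrix_vector_mul_component inner_axis)

lemma krylov_less_gdist: "k < gdist E x w \<Longrightarrow> krylov k x $ w = 0"
  by (simp add: krylov_nth matpow_less_gdist gdist_sym[of x])

lemma krylov_gdist: "krylov (gdist E x w) x $ w > 0"
  by (metis krylov_nth matpow_gdist gdist_sym)

lemma inner_e: "x \<bullet> e w = x $ w" "e w \<bullet> x = x $ w"
  by (simp_all add: basis_vec_def inner_axis inner_axis')

text \<open>At a zero entry the eigenvalue equation makes the sum of the nonnegative neighbouring
  entries vanish, so the zero spreads along walks to the whole graph.\<close>

lemma nonneg_eigenvector_pos:
  fixes x :: "real ^ 'v"
  assumes "\<And>i. x $ i \<ge> 0" and eig: "A *v x = \<rho> *\<^sub>R x" and "x \<noteq> 0"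
  shows "x $ i > 0"
proof (rule ccontr)
  assume "\<not> x $ i > 0"
  then have i: "x $ i = 0"
    using assms(1)[of i] by simp
  have "x $ j = 0" for j
  proof -
    have step: "x $ k = 0" if "x $ j = 0" "E j k" for j k
    proof -
      have "(\<Sum>k | E j k. x $ k) = 0"
        using that eig by (simp flip: A_mult)
      then show ?thesis
        using that assms(1) by (simp add: sum_nonneg_eq_0_iff)
    qed
    obtain n where "walk_len E n i j" using walk_exists by auto
    then show ?thesis using i
      by (induction n arbitrary: i) (use step in \<open>auto simp: walk_Suc\<close>)
  qed
  with \<open>x \<noteq> 0\<close> show False by (simp add: vec_eq_iff)
qed

text \<open>Taking absolute values of a maximiser of the Rayleigh quotient keeps its norm and cannot
  lower the quadratic form, as \<open>A\<close> has nonnegative entries. The result is again a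
  maximiser, hence a nonnegative eigenvector.\<close>

lemma perron_exists:
  "\<exists>\<phi>. (\<forall>i. \<phi> $ i > 0) \<and> A *v \<phi> = Max (eigenvalues A) *\<^sub>R \<phi>"
proof -
  have "\<exists>y\<in>(UNIV :: (real^'v) set). y \<noteq> 0"
    by (rule bexI[of _ "e undefined"]) (auto simp: basis_vec_def axis_eq_0_iff)
  then obtain x \<rho> where x: "x \<noteq> 0" "A *v x = \<rho> *\<^sub>R x" and le: "\<And>y. y \<bullet> (A *v y) \<le> \<rho> * (y \<bullet> y)"
    using rayleigh_max_exists[OF A_sym subspace_UNIV] by (metis UNIV_I)
  define \<phi> :: "real^'v" where "\<phi> = (\<chi> i. \<bar>x $ i\<bar>)"
  have "\<rho> * (\<phi> \<bullet> \<phi>) = \<rho> * (x \<bullet> x)"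
    by (simp add: \<phi>_def inner_vec_def)
  also have "\<dots> = x \<bullet> (A *v x)"
    by (simp add: x)
  also have "\<dots> \<le> \<phi> \<bullet> (A *v \<phi>)"
    unfolding inner_vec_def A_mult
  proof (rule sum_mono)
    fix i
    have "x $ i * (\<Sum>j | E i j. x $ j) \<le> \<bar>x $ i\<bar> * \<bar>\<Sum>j | E i j. x $ j\<bar>"
      by (metis abs_ge_self abs_mult)
    also have "\<dots> \<le> \<bar>x $ i\<bar> * (\<Sum>j | E i j. \<bar>x $ j\<bar>)"
      by (intro mult_left_mono sum_abs) auto
    finally show "x $ i \<bullet> (\<Sum>j | E i j. x $ j) \<le> \<phi> $ i \<bullet> (\<Sum>j | E i j. \<phi> $ j)"
      by (simp add: \<phi>_def)
  qed
  finally have "\<phi> \<bullet> (A *v \<phi>) = \<rho> * (\<phi> \<bullet> \<phi>)"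
    using le by (intro antisym) auto
  then have eig: "A *v \<phi> = \<rho> *\<^sub>R \<phi>"
    by (intro rayleigh_max_eigenvector[OF A_sym subspace_UNIV]) (auto intro: le)
  moreover have "\<phi> \<noteq> 0"
    using \<open>x \<noteq> 0\<close> by (auto simp: \<phi>_def vec_eq_iff)
  ultimately have pos: "\<phi> $ i > 0" for i
    by (intro nonneg_eigenvector_pos[of \<phi> \<rho>]) (auto simp: \<phi>_def)
  have "\<rho> = Max (eigenvalues A)"
  proof (rule Max_eqI[symmetric])
    show "finite (eigenvalues A)" by (rule finite_eigenvalues[OF A_sym])
    show "\<rho> \<in> eigenvalues A" using x by (auto simp: eigenvalues_def)
    fix \<mu> assume "\<mu> \<in> eigenvalues A"
    then obtain y where y: "y \<noteq> 0" "A *v y = \<mu> *\<^sub>R y" by (auto simp: eigenvalues_def)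
    then show "\<mu> \<le> \<rho>" using le[of y] by simp
  qed
  with pos eig show ?thesis by auto
qed

lemma perron_vec: "perron_vec E $ i > 0" "A *v perron_vec E = Max (eigenvalues A) *\<^sub>R perron_vec E"
  using someI_ex[OF perron_exists] by (auto simp: perron_vec_def)

text \<open>Subtract the largest multiple of the Perron vector that leaves all entries nonnegative.
  The remainder has a zero entry, so it vanishes by \<open>nonneg_eigenvector_pos\<close>.\<close>

lemma perron_simple:
  fixes x :: "real ^ 'v"
  assumes x: "A *v x = Max (eigenvalues A) *\<^sub>R x"
  shows "\<exists>c. x = c *\<^sub>R perron_vec E"
proof -
  let ?\<phi> = "perron_vec E"
  define c where "c = Min (range (\<lambda>i. x $ i / ?\<phi> $ i))"
  have le: "c \<le> x $ i / ?\<phi> $ i" for i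
    unfolding c_def by (rule Min_le) auto
  have "c \<in> range (\<lambda>i. x $ i / ?\<phi> $ i)"
    unfolding c_def by (rule Min_in) auto
  then obtain i where i: "c = x $ i / ?\<phi> $ i" by auto
  define y where "y = x - c *\<^sub>R ?\<phi>"
  have "y = 0"
  proof (rule ccontr)
    assume "y \<noteq> 0"
    moreover have "y $ j \<ge> 0" for j
      using le[of j] perron_vec(1)[of j] by (simp add: y_def field_simps)
    moreover have "A *v y = Max (eigenvalues A) *\<^sub>R y"
      by (simp add: y_def matrix_vector_mult_diff_distrib matrix_vector_mult_scaleR x perron_vec(2) scaleR_diff_right)
    ultimately have "y $ i > 0"
      by (intro nonneg_eigenvector_pos) auto
    then show False
      using perron_vec(1)[of i] by (simp add: y_def i)
  qed
  then show ?thesis by (auto simp: y_def)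
qed

text \<open>The exponential series is summed on each eigenspace separately; the weights are the
  entries of the projections.\<close>

lemma exp_iA_spectral:
  "exp_iA_entry E \<tau> w x =
    (\<Sum>\<theta>\<in>eigenvalues A. cis (\<tau> * \<theta>) * complex_of_real ((P \<theta> *v e x) \<bullet> (P \<theta> *v e w)))"
proof -
  have "(\<lambda>k. \<Sum>\<theta>\<in>eigenvalues A. (\<i> * complex_of_real (\<tau> * \<theta>)) ^ k /\<^sub>R fact k *
              complex_of_real ((P \<theta> *v e x) \<bullet> (P \<theta> *v e w)))
        sums (\<Sum>\<theta>\<in>eigenvalues A. exp (\<i> * complex_of_real (\<tau> * \<theta>)) * complex_of_real ((P \<theta> *v e x) \<bullet> (P \<theta> *v e w)))"
    by (intro sums_sum sums_mult2 exp_converges)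
  moreover have "(\<Sum>\<theta>\<in>eigenvalues A. (\<i> * complex_of_real (\<tau> * \<theta>)) ^ k /\<^sub>R fact k *
              complex_of_real ((P \<theta> *v e x) \<bullet> (P \<theta> *v e w)))
      = (\<i> * complex_of_real \<tau>) ^ k / of_nat (fact k) * complex_of_real (matpow A k $ w $ x)" for k
  proof -
    have "matpow A k $ w $ x = (\<Sum>\<theta>\<in>eigenvalues A. \<theta> ^ k * ((P \<theta> *v e x) \<bullet> (P \<theta> *v e w)))"
      using matpow_spectral_inner[OF A_sym, of "e w" k "e x"] by (simp add: inner_e krylov_nth)
    then show ?thesis
      by (simp add: sum_distrib_left power_mult_distrib scaleR_conv_of_real field_simps of_real_inverse)
  qed
  ultimately show ?thesis
    unfolding exp_iA_entry_def by (simp add: sums_iff cis_conv_exp)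
qed

end

section \<open>Cospectral vertices\<close>

text \<open>In the Leibniz formula a permutation that moves \<open>w\<close> meets a zero of the
  unit column; the others are the permutations of \<open>UNIV - {w}\<close>.\<close>

lemma det_replace_column:
  fixes N :: "real ^ 'n ^ 'n"
  shows "det (\<chi> i j. if j = w then axis w 1 $ i else N $ i $ j) = det_on (UNIV - {w}) (\<lambda>i j. N $ i $ j)"
proof -
  let ?N' = "\<lambda>i j. if j = w then axis w 1 $ i else N $ i $ j"
  have "det (\<chi> i j. ?N' i j) = (\<Sum>p | p permutes UNIV. of_int (sign p) * (\<Prod>i\<in>UNIV. ?N' i (p i)))"
    by (simp add: det_def)
  also have "\<dots> = (\<Sum>p | p permutes (UNIV - {w}). of_int (sign p) * (\<Prod>i\<in>UNIV. ?N' i (p i)))"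
  proof (rule sum.mono_neutral_right)
    show "{p. p permutes (UNIV - {w})} \<subseteq> {p. p permutes UNIV}"
      by (auto intro: permutes_subset)
    show "\<forall>p\<in>{p. p permutes UNIV} - {p. p permutes (UNIV - {w})}.
        of_int (sign p) * (\<Prod>i\<in>UNIV. ?N' i (p i)) = 0"
    proof
      fix p :: "'n \<Rightarrow> 'n" assume p: "p \<in> {p. p permutes UNIV} - {p. p permutes (UNIV - {w})}"
      then have "p w \<noteq> w"
        using permutes_superset[of p UNIV "UNIV - {w}"] by auto
      moreover obtain i where "p i = w"
        using p by (metis DiffD1 mem_Collect_eq permutes_def)
      ultimately have "?N' i (p i) = 0"
        by (auto simp: axis_def)
      then have "(\<Prod>i\<in>UNIV. ?N' i (p i)) = 0"
        by (intro prod_zero bexI[of _ i]) simp_all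
      then show "of_int (sign p) * (\<Prod>i\<in>UNIV. ?N' i (p i)) = 0"
        by simp
    qed
  qed simp
  also have "\<dots> = det_on (UNIV - {w}) (\<lambda>i j. N $ i $ j)"
    unfolding det_on_def
  proof (rule sum.cong[OF refl])
    fix p assume "p \<in> {p. p permutes (UNIV - {w})}"
    then have p: "p permutes (UNIV - {w})" by simp
    then have "p w = w" by (simp add: permutes_not_in)
    then have "p i \<noteq> w" if "i \<noteq> w" for i
      using p that by (metis permutes_inj injD)
    then have "(\<Prod>i\<in>UNIV - {w}. ?N' i (p i)) = (\<Prod>i\<in>UNIV - {w}. N $ i $ p i)"
      by (intro prod.cong) auto
    moreover have "(\<Prod>i\<in>UNIV. ?N' i (p i)) = ?N' w (p w) * (\<Prod>i\<in>UNIV - {w}. ?N' i (p i))"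
      by (rule prod.remove) auto
    ultimately show "of_int (sign p) * (\<Prod>i\<in>UNIV. ?N' i (p i)) = of_int (sign p) * (\<Prod>i\<in>UNIV - {w}. N $ i $ p i)"
      using \<open>p w = w\<close> by simp
  qed
  finally show ?thesis .
qed

context conn_graph
begin

text \<open>This computes the diagonal entry of the resolvent at \<open>w\<close> in two ways:
  Cramer's rule gives \<open>charpoly_deleted\<close> over the full determinant, the spectral
  decomposition gives a sum of simple fractions.\<close>

lemma charpoly_deleted_spectral:
  assumes t: "t \<notin> eigenvalues A"
  shows "charpoly_deleted E w t =
    det (t *\<^sub>R mat 1 - A) * (\<Sum>\<theta>\<in>eigenvalues A. ((P \<theta> *v e w) \<bullet> (P \<theta> *v e w)) / (t - \<theta>))"
    and "det (t *\<^sub>R mat 1 - A) \<noteq> 0"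
proof -
  let ?N = "t *\<^sub>R mat 1 - A"
  have N: "?N *v x = t *\<^sub>R x - A *v x" for x
    by (simp add: matrix_vector_mult_diff_rdistrib scaleR_matrix_vector_assoc[symmetric])
  have "x = 0" if "?N *v x = 0" for x
    using that t by (auto simp: N eigenvalues_def)
  then have "invertible ?N"
    unfolding invertible_left_inverse matrix_left_invertible_ker by (intro allI impI)
  then show det: "det ?N \<noteq> 0"
    by (simp add: invertible_det_nz)
  define x where "x = (\<Sum>\<theta>\<in>eigenvalues A. (1 / (t - \<theta>)) *\<^sub>R (P \<theta> *v e w))"
  have "?N *v x = (\<Sum>\<theta>\<in>eigenvalues A. ?N *v ((1 / (t - \<theta>)) *\<^sub>R (P \<theta> *v e w)))"
    unfolding x_def by (rule linear_sum) (rule matrix_vector_mul_linear)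
  also have "\<dots> = (\<Sum>\<theta>\<in>eigenvalues A. P \<theta> *v e w)"
  proof (rule sum.cong[OF refl])
    fix \<theta> assume "\<theta> \<in> eigenvalues A"
    then have "t - \<theta> \<noteq> 0" using t by auto
    have "?N *v (P \<theta> *v e w) = (t - \<theta>) *\<^sub>R (P \<theta> *v e w)"
      by (simp add: N eig_proj_eigen[OF A_sym] scaleR_diff_left)
    then show "?N *v ((1 / (t - \<theta>)) *\<^sub>R (P \<theta> *v e w)) = P \<theta> *v e w"
      using \<open>t - \<theta> \<noteq> 0\<close> by (simp add: matrix_vector_mult_scaleR)
  qed
  also have "\<dots> = e w"
    by (rule sum_eig_proj[OF A_sym])
  finally have "x $ w = det (\<chi> i j. if j = w then axis w 1 $ i else ?N $ i $ j) / det ?N"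
    using cramer[OF det, of x "e w"] unfolding basis_vec_def by simp
  also have "\<dots> = charpoly_deleted E w t / det ?N"
  proof -
    have "($) (?N $ i) = (\<lambda>j. (if i = j then t else 0) - (if E i j then 1 else 0))" for i
      by (auto simp: mat_def adj_matrix_def)
    then show ?thesis
      unfolding det_replace_column charpoly_deleted_def by (simp only:)
  qed
  finally have "charpoly_deleted E w t = det ?N * x $ w"
    using det by simp
  also have "x $ w = (\<Sum>\<theta>\<in>eigenvalues A. ((P \<theta> *v e w) \<bullet> (P \<theta> *v e w)) / (t - \<theta>))"
    by (simp add: x_def eig_proj_inner'[OF A_sym, symmetric] inner_e)
  finally show "charpoly_deleted E w t =
    det ?N * (\<Sum>\<theta>\<in>eigenvalues A. ((P \<theta> *v e w) \<bullet> (P \<theta> *v e w)) / (t - \<theta>))" .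
qed

lemma continuous_charpoly_deleted: "isCont (charpoly_deleted E w) t"
proof -
  have "isCont (\<lambda>t. (if i = j then t else 0) - (if E i j then 1 else 0 :: real)) t" for i j
    by (cases "i = j") (auto intro!: continuous_intros)
  then show ?thesis
    unfolding charpoly_deleted_def det_on_def
    by (intro continuous_sum continuous_mult continuous_const continuous_prod)
qed

end

text \<open>Multiplying by \<open>t - \<mu>\<close> and letting \<open>t\<close> tend to \<mu>
  isolates the residue \<open>c \<mu>\<close>.\<close>

lemma partial_fractions_unique:
  fixes c :: "real \<Rightarrow> real"
  assumes fin: "finite S" and 0: "\<And>t. t \<notin> S \<Longrightarrow> (\<Sum>\<theta>\<in>S. c \<theta> / (t - \<theta>)) = 0" and \<mu>: "\<mu> \<in> S"
  shows "c \<mu> = 0"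
proof -
  let ?f = "\<lambda>t. c \<mu> + (t - \<mu>) * (\<Sum>\<theta>\<in>S - {\<mu>}. c \<theta> / (t - \<theta>))"
  have "(?f \<longlongrightarrow> c \<mu> + (\<mu> - \<mu>) * (\<Sum>\<theta>\<in>S - {\<mu>}. c \<theta> / (\<mu> - \<theta>))) (at \<mu>)"
    by (intro tendsto_intros) auto
  then have "(?f \<longlongrightarrow> c \<mu>) (at \<mu>)" by simp
  moreover have "eventually (\<lambda>t. ?f t = 0) (at \<mu>)"
  proof -
    have "eventually (\<lambda>t. t \<in> - (S - {\<mu>})) (nhds \<mu>)"
      using fin by (intro eventually_nhds_in_open open_Compl finite_imp_closed) auto
    then have "eventually (\<lambda>t. t \<in> - (S - {\<mu>})) (at \<mu>)"
      unfolding eventually_at_filter by eventually_elim auto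
    moreover have "eventually (\<lambda>t. t \<noteq> \<mu>) (at \<mu>)"
      by (rule eventually_neq_at_within)
    ultimately show ?thesis
    proof eventually_elim
      case (elim t)
      then have "(\<Sum>\<theta>\<in>S. c \<theta> / (t - \<theta>)) = 0" by (intro 0) auto
      then have "c \<mu> / (t - \<mu>) + (\<Sum>\<theta>\<in>S - {\<mu>}. c \<theta> / (t - \<theta>)) = 0"
        by (simp add: sum.remove[OF fin \<mu>])
      then show ?case using elim(2) by (simp add: field_simps)
    qed
  qed
  ultimately have "((\<lambda>t. 0) \<longlongrightarrow> c \<mu>) (at \<mu>)"
    by (rule Lim_transform_eventually)
  then show ?thesis
    by (metis tendsto_const tendsto_unique at_neq_bot)
qed

context conn_graph
begin

text \<open>Off the spectrum, the deleted characteristic polynomials are a common nonzero factor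
  times partial fractions whose coefficients are the squared norms of the projections.\<close>

lemma cospectral_iff:
  "cospectral_vertices E x y \<longleftrightarrow> (\<forall>\<theta>. norm (P \<theta> *v e x) = norm (P \<theta> *v e y))"
proof
  assume cos: "cospectral_vertices E x y"
  let ?c = "\<lambda>\<theta>. (P \<theta> *v e x) \<bullet> (P \<theta> *v e x) - (P \<theta> *v e y) \<bullet> (P \<theta> *v e y)"
  have "(\<Sum>\<theta>\<in>eigenvalues A. ?c \<theta> / (t - \<theta>)) = 0" if "t \<notin> eigenvalues A" for t
  proof -
    have "charpoly_deleted E x t = charpoly_deleted E y t"
      using cos by (simp add: cospectral_vertices_def)
    then show ?thesis
      unfolding charpoly_deleted_spectral(1)[OF that] diff_divide_distrib sum_subtractf
      using charpoly_deleted_spectral(2)[OF that] by simp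
  qed
  then have "?c \<theta> = 0" if "\<theta> \<in> eigenvalues A" for \<theta>
    using partial_fractions_unique[OF finite_eigenvalues[OF A_sym], of ?c] that by blast
  then have "norm (P \<theta> *v e x) = norm (P \<theta> *v e y)" if "\<theta> \<in> eigenvalues A" for \<theta>
    unfolding norm_eq using that by simp
  moreover have "P \<theta> *v e x = 0" "P \<theta> *v e y = 0" if "\<theta> \<notin> eigenvalues A" for \<theta>
    using that eig_proj_nonzero_eigenvalue[OF A_sym] by blast+
  ultimately show "\<forall>\<theta>. norm (P \<theta> *v e x) = norm (P \<theta> *v e y)"
    by (metis (no_types))
next
  assume eq: "\<forall>\<theta>. norm (P \<theta> *v e x) = norm (P \<theta> *v e y)"
  have off: "charpoly_deleted E x t = charpoly_deleted E y t" if "t \<notin> eigenvalues A" for t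
    unfolding charpoly_deleted_spectral(1)[OF that] dot_square_norm using eq by simp
  show "cospectral_vertices E x y"
    unfolding cospectral_vertices_def
  proof
    fix t
    \<comment> \<open>The resolvent formula is silent at eigenvalues. These are finitely many, so
      the polynomials agree on a punctured neighbourhood of \<open>t\<close>, and continuity gives
      agreement at \<open>t\<close>.\<close>
    have "eventually (\<lambda>s. s \<in> - (eigenvalues A - {t})) (nhds t)"
      using finite_eigenvalues[OF A_sym] by (intro eventually_nhds_in_open open_Compl finite_imp_closed) auto
    then have "eventually (\<lambda>s. charpoly_deleted E x s = charpoly_deleted E y s) (at t)"
      unfolding eventually_at_filter by eventually_elim (use off in auto)
    moreover have lim: "(charpoly_deleted E x \<longlongrightarrow> charpoly_deleted E x t) (at t)"
        "(charpoly_deleted E y \<longlongrightarrow> charpoly_deleted E y t) (at t)"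
      using continuous_charpoly_deleted by (auto simp: isCont_def)
    ultimately have "(charpoly_deleted E y \<longlongrightarrow> charpoly_deleted E x t) (at t)"
      by (blast intro: Lim_transform_eventually)
    with lim(2) show "charpoly_deleted E x t = charpoly_deleted E y t"
      by (metis at_neq_bot tendsto_unique)
  qed
qed

end

section \<open>Spectrally extremal vertices\<close>

text \<open>Independence of a set does not see repetitions in a family, so injectivity is derived as
  well; the dimension counts below need the image to be as large as the index set.\<close>

lemma independent_family:
  fixes x :: "'i \<Rightarrow> 'a :: real_vector"
  assumes fin: "finite I" and zero: "\<And>c. (\<Sum>i\<in>I. c i *\<^sub>R x i) = 0 \<Longrightarrow> \<forall>i\<in>I. c i = 0"
  shows "inj_on x I" "independent (x ` I)"
proof -
  show inj: "inj_on x I"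
  proof (rule inj_onI, rule ccontr)
    fix i j assume ij: "i \<in> I" "j \<in> I" "x i = x j" "i \<noteq> j"
    let ?c = "\<lambda>k. if k = i then 1 else if k = j then - 1 else 0 :: real"
    have "(\<Sum>k\<in>I. ?c k *\<^sub>R x k) = (\<Sum>k\<in>{i, j}. ?c k *\<^sub>R x k)"
      by (rule sum.mono_neutral_right) (use fin ij(1,2) in auto)
    also have "\<dots> = 0" using ij(3,4) by simp
    finally have "?c i = 0" using zero[of ?c] ij(1) by blast
    then show False by simp
  qed
  show "independent (x ` I)"
  proof (rule independent_if_scalars_zero)
    fix f y assume "(\<Sum>y\<in>x ` I. f y *\<^sub>R y) = 0" and y: "y \<in> x ` I"
    then have "(\<Sum>i\<in>I. f (x i) *\<^sub>R x i) = 0"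
      by (simp add: sum.reindex[OF inj])
    from zero[OF this] y show "f y = 0" by blast
  qed (use fin in auto)
qed

lemma span_family:
  fixes x :: "'i \<Rightarrow> 'a :: real_vector"
  assumes "finite I" "inj_on x I" "y \<in> span (x ` I)"
  obtains c where "y = (\<Sum>i\<in>I. c i *\<^sub>R x i)"
proof -
  from assms obtain f where "y = (\<Sum>z\<in>x ` I. f z *\<^sub>R z)"
    by (auto simp: span_finite)
  then have "y = (\<Sum>i\<in>I. f (x i) *\<^sub>R x i)"
    using assms by (simp add: sum.reindex)
  then show thesis by (rule that)
qed

locale extremal_pair = conn_graph E for E :: "'v::finite \<Rightarrow> 'v \<Rightarrow> bool" +
  fixes u v :: 'v
  assumes extremal: "spectrally_extremal E u" and dist_ecc: "gdist E u v = ecc E u"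
begin

abbreviation "d \<equiv> dual_degree E u"
abbreviation "\<Phi> \<equiv> eig_support E u"
abbreviation "th \<equiv> supp_eig E u"

lemma ecc_u: "ecc E u = d"
  using extremal by (simp add: spectrally_extremal_def)

lemma gdist_uv: "gdist E u v = d"
  using dist_ecc ecc_u by simp

section \<open>The eigenvalue support of \<open>u\<close> and its ordering\<close>

lemma support_iff: "\<theta> \<in> \<Phi> \<longleftrightarrow> P \<theta> *v e u \<noteq> 0"
  by (auto simp: eig_support_def intro: eig_proj_nonzero_eigenvalue[OF A_sym])

lemma support_subset: "\<Phi> \<subseteq> eigenvalues A"
  by (auto simp: eig_support_def)

lemma finite_support: "finite \<Phi>"
  using support_subset finite_eigenvalues[OF A_sym] by (rule finite_subset)

text \<open>Subtraction in \<open>dual_degree\<close> truncates, so the support has to be nonempty: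
  \<open>e u\<close> is nonzero and is the sum of its projections.\<close>

lemma card_support: "card \<Phi> = Suc d"
proof -
  have "e u \<noteq> 0" by (simp add: basis_vec_def axis_eq_0_iff)
  have "\<Phi> \<noteq> {}"
  proof
    assume "\<Phi> = {}"
    then have "P \<theta> *v e u = 0" for \<theta> using support_iff by blast
    then show False
      using sum_eig_proj[OF A_sym, of "e u"] \<open>e u \<noteq> 0\<close> by simp
  qed
  then show ?thesis
    using finite_support card_gt_0_iff[of \<Phi>] by (simp add: dual_degree_def)
qed

lemma supp_eig_strict: "r < s \<Longrightarrow> s \<le> d \<Longrightarrow> th s < th r"
proof -
  assume rs: "r < s" "s \<le> d"
  let ?l = "sorted_list_of_set \<Phi>"
  have len: "length ?l = Suc d"
    by (simp add: card_support)
  have "?l ! (d - s) < ?l ! (d - r)"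
    using rs len strict_sorted_list_of_set[of \<Phi>] sorted_wrt_nth_less[of "(<)" ?l "d - s" "d - r"] by simp
  then show "th s < th r"
    using rs len by (simp add: supp_eig_def rev_nth)
qed

lemma supp_eig_bij: "bij_betw th {..d} \<Phi>"
proof (rule bij_betw_imageI)
  show inj: "inj_on th {..d}"
  proof (rule linorder_inj_onI')
    fix i j assume "i < j" "j \<in> {..d}"
    then show "th i \<noteq> th j" using supp_eig_strict[of i j] by simp
  qed
  have "th r \<in> \<Phi>" if "r \<le> d" for r
  proof -
    have "th r \<in> set (rev (sorted_list_of_set \<Phi>))"
      unfolding supp_eig_def by (rule nth_mem) (use that in \<open>simp add: card_support\<close>)
    then show ?thesis using finite_support by simp
  qed
  then have "th ` {..d} \<subseteq> \<Phi>" by auto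
  moreover have "card (th ` {..d}) = card \<Phi>"
    using inj by (simp add: card_image card_support)
  ultimately show "th ` {..d} = \<Phi>"
    using finite_support by (intro card_subset_eq)
qed

lemma supp_eig_in: "r \<le> d \<Longrightarrow> th r \<in> \<Phi>"
  using supp_eig_bij by (auto simp: bij_betw_def)

lemma supp_eig_cases:
  obtains "\<theta> \<notin> \<Phi>" | r where "r \<le> d" "\<theta> = th r"
  using supp_eig_bij unfolding bij_betw_def by blast

text \<open>By symmetry and idempotence of the projection, this is its entry at
  \<open>(v, u)\<close>.\<close>

abbreviation "coef \<theta> \<equiv> (P \<theta> *v e u) \<bullet> (P \<theta> *v e v)"

lemma sum_eigenvalues_support:
  fixes f :: "real \<Rightarrow> 'a :: comm_monoid_add"
  assumes "\<And>\<theta>. P \<theta> *v e u = 0 \<Longrightarrow> f \<theta> = 0"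
  shows "(\<Sum>\<theta>\<in>eigenvalues A. f \<theta>) = (\<Sum>r\<le>d. f (th r))"
proof -
  have "(\<Sum>\<theta>\<in>eigenvalues A. f \<theta>) = (\<Sum>\<theta>\<in>\<Phi>. f \<theta>)"
    by (rule sum.mono_neutral_right)
      (use support_subset finite_eigenvalues[OF A_sym] support_iff assms in auto)
  also have "\<dots> = (\<Sum>r\<le>d. f (th r))"
    by (rule sum.reindex_bij_betw[OF supp_eig_bij, symmetric])
  finally show ?thesis .
qed

text \<open>The sum is the \<open>(v, u)\<close> entry of \<open>q\<close> evaluated at
  \<open>A\<close>. No walk from \<open>u\<close> to \<open>v\<close> is shorter than
  \<open>d\<close>, so only the leading term survives.\<close>

lemma sum_poly_coef:
  assumes "degree q = d"
  shows "(\<Sum>r\<le>d. poly q (th r) * coef (th r)) = lead_coeff q * matpow A d $ v $ u"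
proof -
  have *: "(\<Sum>r\<le>d. th r ^ k * coef (th r)) = matpow A k $ v $ u" for k
    using matpow_spectral_inner[OF A_sym, of "e v" k "e u"]
    by (subst sum_eigenvalues_support[symmetric]) (simp_all add: inner_e krylov_nth)
  have "(\<Sum>r\<le>d. poly q (th r) * coef (th r)) = (\<Sum>r\<le>d. \<Sum>k\<le>d. coeff q k * (th r ^ k * coef (th r)))"
    by (simp add: poly_altdef assms sum_distrib_right mult.assoc)
  also have "\<dots> = (\<Sum>k\<le>d. coeff q k * matpow A k $ v $ u)"
    by (subst sum.swap) (simp add: sum_distrib_left[symmetric] *)
  also have "\<dots> = (\<Sum>k\<le>d. if k = d then coeff q k * matpow A k $ v $ u else 0)"
    by (rule sum.cong[OF refl]) (auto simp: matpow_less_gdist gdist_sym[of v] gdist_uv)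
  also have "\<dots> = lead_coeff q * matpow A d $ v $ u"
    by (simp add: assms)
  finally show ?thesis .
qed

text \<open>For the monic \<open>q\<close> of degree \<open>d\<close> vanishing at the other support
  points, \<open>sum_poly_coef\<close> makes \<open>poly q (th r) * coef (th r)\<close> positive.
  Exactly the \<open>r\<close> larger eigenvalues contribute negative factors to
  \<open>poly q (th r)\<close>.\<close>

lemma coef_sign:
  assumes r: "r \<le> d"
  shows "(- 1) ^ r * coef (th r) > 0"
proof -
  define q where "q = (\<Prod>s\<in>{..d} - {r}. [:- th s, 1:])"
  have "degree q = d"
    using r by (simp add: q_def degree_prod_eq_sum_degree)
  moreover have "lead_coeff q = 1"
    by (simp add: q_def lead_coeff_prod)
  moreover have "poly q (th s) = 0" if "s \<le> d" "s \<noteq> r" for s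
    using that by (auto simp: q_def poly_prod)
  then have "(\<Sum>s\<le>d. poly q (th s) * coef (th s)) = (\<Sum>s\<le>d. if s = r then poly q (th s) * coef (th s) else 0)"
    by (intro sum.cong) auto
  then have "(\<Sum>s\<le>d. poly q (th s) * coef (th s)) = poly q (th r) * coef (th r)"
    using r by simp
  ultimately have "poly q (th r) * coef (th r) = matpow A d $ v $ u"
    using sum_poly_coef[of q] by simp
  also have "\<dots> > 0"
    using matpow_gdist[of v u] by (simp add: gdist_sym[of v] gdist_uv)
  finally have pos: "poly q (th r) * coef (th r) > 0" .
  have split: "{..d} - {r} = {..<r} \<union> {r<..d}" using r by auto
  have "poly q (th r) = (\<Prod>s\<in>{..d} - {r}. th r - th s)"
    by (simp add: q_def poly_prod)
  also have "\<dots> = (\<Prod>s<r. th r - th s) * (\<Prod>s\<in>{r<..d}. th r - th s)"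
    unfolding split by (rule prod.union_disjoint) auto
  also have "(\<Prod>s<r. th r - th s) = (- 1) ^ r * (\<Prod>s<r. th s - th r)"
    using prod_uminus[of "\<lambda>s. th s - th r" "{..<r}"] by simp
  finally have "(- 1) ^ r * poly q (th r) = (\<Prod>s<r. th s - th r) * (\<Prod>s\<in>{r<..d}. th r - th s)"
    by (simp add: mult.assoc[symmetric] power_add[symmetric] flip: mult_2)
  also have "\<dots> > 0"
    using supp_eig_strict r by (intro mult_pos_pos prod_pos) auto
  finally have "((- 1) ^ r * poly q (th r)) > 0" .
  moreover have "((- 1) ^ r * poly q (th r)) * ((- 1) ^ r * coef (th r)) = poly q (th r) * coef (th r)"
    by (simp add: algebra_simps flip: power_add mult_2)
  ultimately show ?thesis
    using pos by (metis zero_less_mult_pos)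
qed

text \<open>An entry of modulus one is the equality case of the Cauchy-Schwarz inequality for the
  projections of \<open>e u\<close> and \<open>e v\<close>; \<open>coef_sign\<close> then fixes the
  signs.\<close>

lemma pst_spectral:
  assumes "pst_at E u v \<tau>"
  obtains z where "cmod z = 1" "\<And>r. r \<le> d \<Longrightarrow> cis (\<tau> * th r) = (- 1) ^ r * z"
    "\<And>r. r \<le> d \<Longrightarrow> P (th r) *v e v = (- 1) ^ r *\<^sub>R (P (th r) *v e u)"
    "\<And>\<theta>. \<theta> \<notin> \<Phi> \<Longrightarrow> P \<theta> *v e v = 0"
proof -
  define z where "z = (\<Sum>\<theta>\<in>eigenvalues A. cis (\<tau> * \<theta>) * complex_of_real (coef \<theta>))"
  have z: "cmod z = 1"
    using assms by (simp add: pst_at_def exp_iA_spectral z_def)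
  \<comment> \<open>Rotating by the conjugate of \<open>z\<close> turns the entry into 1; taking
    real parts leaves real weights of absolute value at most 1.\<close>
  define \<eta> where "\<eta> \<theta> = Re (cnj z * cis (\<tau> * \<theta>))" for \<theta>
  have \<eta>_le: "\<bar>\<eta> \<theta>\<bar> \<le> 1" for \<theta>
    using abs_Re_le_cmod[of "cnj z * cis (\<tau> * \<theta>)"] z by (simp add: \<eta>_def norm_mult)
  have "(\<Sum>\<theta>\<in>eigenvalues A. \<eta> \<theta> * coef \<theta>) = Re (cnj z * z)"
    unfolding z_def[of] \<eta>_def sum_distrib_left Re_sum by (simp add: algebra_simps)
  also have "\<dots> = 1"
    using z complex_norm_square[of z] by (simp add: mult.commute)
  finally have sum1: "(\<Sum>\<theta>\<in>eigenvalues A. \<eta> \<theta> * coef \<theta>) = 1" .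
  have unit: "(\<Sum>\<theta>\<in>eigenvalues A. (P \<theta> *v e x) \<bullet> (P \<theta> *v e x)) = 1" for x
    by (subst inner_eig_proj[OF A_sym, symmetric]) (simp add: inner_e, simp add: basis_vec_def)
  have proj: "P \<theta> *v e x = \<eta> \<theta> *\<^sub>R (P \<theta> *v e y)" if xy: "x = u \<and> y = v \<or> x = v \<and> y = u" for x y \<theta>
  proof (cases "\<theta> \<in> eigenvalues A")
    case True
    \<comment> \<open>Summed over the spectrum, the upper bounds for these squared distances give
      \<open>1 + 1 - 2 = 0\<close>, so every distance vanishes.\<close>
    let ?D = "\<lambda>\<theta>. (norm (P \<theta> *v e x - \<eta> \<theta> *\<^sub>R (P \<theta> *v e y)))\<^sup>2"
    have "?D \<theta> \<le> (P \<theta> *v e x) \<bullet> (P \<theta> *v e x) + (P \<theta> *v e y) \<bullet> (P \<theta> *v e y) - 2 * (\<eta> \<theta> * coef \<theta>)" for \<theta>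
    proof -
      have "(\<eta> \<theta>)\<^sup>2 \<le> 1" using \<eta>_le abs_le_square_iff[of "\<eta> \<theta>" 1] by simp
      then have "(\<eta> \<theta>)\<^sup>2 * ((P \<theta> *v e y) \<bullet> (P \<theta> *v e y)) \<le> (P \<theta> *v e y) \<bullet> (P \<theta> *v e y)"
        by (intro mult_left_le_one_le) auto
      moreover have "(P \<theta> *v e x) \<bullet> (P \<theta> *v e y) = coef \<theta>"
        using xy by (auto simp: inner_commute)
      ultimately show ?thesis
        unfolding power2_norm_eq_inner
        by (simp add: inner_diff_left inner_diff_right power2_eq_square algebra_simps
              inner_commute[of "P \<theta> *v e y" "P \<theta> *v e x"])
    qed
    then have "(\<Sum>\<theta>\<in>eigenvalues A. ?D \<theta>) \<le>
        (\<Sum>\<theta>\<in>eigenvalues A. (P \<theta> *v e x) \<bullet> (P \<theta> *v e x) + (P \<theta> *v e y) \<bullet> (P \<theta> *v e y) - 2 * (\<eta> \<theta> * coef \<theta>))"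
      by (rule sum_mono)
    also have "\<dots> = 0"
      by (simp add: sum.distrib sum_subtractf unit sum1 flip: sum_distrib_left)
    finally have "(\<Sum>\<theta>\<in>eigenvalues A. ?D \<theta>) = 0"
      by (intro antisym sum_nonneg) auto
    then have "?D \<theta> = 0"
      using True finite_eigenvalues[OF A_sym] by (simp add: sum_nonneg_eq_0_iff)
    then show ?thesis by simp
  next
    case False
    then have "P \<theta> *v w = 0" for w
      using eig_proj_nonzero_eigenvalue[OF A_sym] by blast
    then show ?thesis by simp
  qed
  have eta_r: "\<eta> (th r) = (- 1) ^ r" if r: "r \<le> d" for r
  proof -
    let ?p = "P (th r) *v e u"
    have "?p \<noteq> 0" using supp_eig_in[OF r] support_iff by simp
    \<comment> \<open>Using \<open>proj\<close> in both directions makes the weight a square root of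
      1.\<close>
    have "?p = \<eta> (th r) *\<^sub>R (P (th r) *v e v)" and v: "P (th r) *v e v = \<eta> (th r) *\<^sub>R ?p"
      using proj by blast+
    then have "?p = (\<eta> (th r) * \<eta> (th r)) *\<^sub>R ?p"
      by (metis scaleR_scaleR)
    then have "\<eta> (th r) * \<eta> (th r) = 1"
      using \<open>?p \<noteq> 0\<close> by (metis scaleR_cancel_right scaleR_one)
    then have sq: "\<eta> (th r) = 1 \<or> \<eta> (th r) = - 1"
      by (simp add: square_eq_1_iff)
    have "0 < ((- 1) ^ r * \<eta> (th r)) * (?p \<bullet> ?p)"
      using coef_sign[OF r] v by (simp add: mult.assoc)
    moreover have "0 < ?p \<bullet> ?p"
      using \<open>?p \<noteq> 0\<close> by simp
    ultimately have "0 < (- 1) ^ r * \<eta> (th r)"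
      by (rule zero_less_mult_pos2)
    with sq show ?thesis
      by (cases "even r") auto
  qed
  show thesis
  proof (rule that[of z])
    fix r assume r: "r \<le> d"
    let ?w = "cnj z * cis (\<tau> * th r)"
    have Re: "Re ?w = (- 1) ^ r"
      using eta_r[OF r] by (simp add: \<eta>_def)
    have "cmod ?w = 1" using z by (simp add: norm_mult)
    then have "(Re ?w)\<^sup>2 + (Im ?w)\<^sup>2 = 1"
      using cmod_power2[of ?w] by simp
    then have "Im ?w = 0"
      unfolding Re by (simp add: power_mult[symmetric] mult.commute)
    then have w: "?w = (- 1) ^ r"
      using Re by (cases "even r") (auto simp: complex_eq_iff)
    have "z * cnj z = 1" using z complex_norm_square[of z] by simp
    then have "cis (\<tau> * th r) = z * ?w" by (simp add: mult.assoc[symmetric])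
    then show "cis (\<tau> * th r) = (- 1) ^ r * z" using w by simp
    show "P (th r) *v e v = (- 1) ^ r *\<^sub>R (P (th r) *v e u)"
      using proj[of v u "th r"] eta_r[OF r] by simp
  next
    fix \<theta> assume "\<theta> \<notin> \<Phi>"
    then show "P \<theta> *v e v = 0"
      using proj[of v u \<theta>] support_iff by simp
  qed (rule z)
qed

lemma pst_if_spectral:
  assumes z: "cmod z = 1" and cis: "\<And>r. r \<le> d \<Longrightarrow> cis (\<tau> * th r) = (- 1) ^ r * z"
    and proj: "\<And>r. r \<le> d \<Longrightarrow> P (th r) *v e v = (- 1) ^ r *\<^sub>R (P (th r) *v e u)"
  shows "pst_at E u v \<tau>"
proof -
  have "exp_iA_entry E \<tau> v u = (\<Sum>r\<le>d. cis (\<tau> * th r) * complex_of_real (coef (th r)))"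
    unfolding exp_iA_spectral by (rule sum_eigenvalues_support) simp
  also have "\<dots> = (\<Sum>r\<le>d. z * complex_of_real ((P (th r) *v e u) \<bullet> (P (th r) *v e u)))"
  proof (rule sum.cong[OF refl])
    fix r assume "r \<in> {..d}"
    then show "cis (\<tau> * th r) * complex_of_real (coef (th r)) = z * complex_of_real ((P (th r) *v e u) \<bullet> (P (th r) *v e u))"
      using cis[of r] proj[of r] by (cases "even r") auto
  qed
  also have "\<dots> = z * complex_of_real (\<Sum>r\<le>d. (P (th r) *v e u) \<bullet> (P (th r) *v e u))"
    by (simp add: sum_distrib_left)
  also have "(\<Sum>r\<le>d. (P (th r) *v e u) \<bullet> (P (th r) *v e u)) = e u \<bullet> e u"
    unfolding inner_eig_proj[OF A_sym, of "e u" "e u"]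
    by (rule sum_eigenvalues_support[symmetric]) simp
  also have "\<dots> = 1" by (simp add: basis_vec_def)
  finally show ?thesis using z by (simp add: pst_at_def)
qed

end

section \<open>Krylov spaces and the distance partition\<close>

context extremal_pair
begin

text \<open>This is the Krylov space of \<open>e u\<close>; spanning it by projections makes its
  invariance and the bound \<open>d + 1\<close> on its dimension immediate.\<close>

definition "K = span ((\<lambda>\<theta>. P \<theta> *v e u) ` \<Phi>)"

lemma dim_K: "dim K \<le> Suc d"
proof -
  have "dim K \<le> card ((\<lambda>\<theta>. P \<theta> *v e u) ` \<Phi>)"
    unfolding K_def dim_span by (rule dim_le_card') (simp add: finite_support)
  also have "\<dots> \<le> Suc d"
    using card_image_le[OF finite_support] card_support by metis
  finally show ?thesis .
qed

lemma subspace_K: "subspace K"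
  by (simp add: K_def)

lemma proj_in_K: "P \<theta> *v e u \<in> K"
proof (cases "\<theta> \<in> \<Phi>")
  case True
  then show ?thesis unfolding K_def by (intro span_base imageI)
next
  case False
  then have "P \<theta> *v e u = 0" using support_iff by blast
  then show ?thesis by (simp add: subspace_0[OF subspace_K])
qed

lemma K_invariant:
  assumes "y \<in> K" shows "A *v y \<in> K"
proof -
  have "(\<lambda>\<theta>. P \<theta> *v e u) ` \<Phi> \<subseteq> {y. A *v y \<in> K}"
    by (auto simp: eig_proj_eigen[OF A_sym] intro!: subspace_scale[OF subspace_K] proj_in_K)
  moreover have "subspace {y. A *v y \<in> K}"
    using subspace_K by (auto simp: subspace_def matrix_vector_right_distrib matrix_vector_mult_scaleR)
  ultimately have "K \<subseteq> {y. A *v y \<in> K}"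
    unfolding K_def by (rule span_minimal)
  then show ?thesis using assms by blast
qed

text \<open>The projection for \<theta> kills the generators of \<open>K\<close> that belong to
  other eigenvalues and fixes its own.\<close>

lemma K_proj:
  assumes "y \<in> K" shows "\<exists>\<beta>. P \<theta> *v y = \<beta> *\<^sub>R (P \<theta> *v e u)"
proof -
  let ?S = "{y. P \<theta> *v y \<in> span {P \<theta> *v e u}}"
  have "P \<theta> *v (P \<mu> *v e u) \<in> span {P \<theta> *v e u}" for \<mu>
  proof (cases "\<mu> = \<theta>")
    case True
    then show ?thesis
      by (simp add: eig_proj_id[OF A_sym eig_proj_eigenspace[OF A_sym]] span_base)
  next
    case False
    then show ?thesis
      by (simp add: eig_proj_zero[OF A_sym eig_proj_eigenspace[OF A_sym]] span_zero)
  qed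
  then have "(\<lambda>\<theta>. P \<theta> *v e u) ` \<Phi> \<subseteq> ?S" by blast
  moreover have "subspace ?S"
    by (auto simp: subspace_def matrix_vector_right_distrib matrix_vector_mult_scaleR
        intro: span_zero span_add span_scale)
  ultimately have "K \<subseteq> ?S"
    unfolding K_def by (rule span_minimal)
  then have "P \<theta> *v y \<in> span {P \<theta> *v e u}" using assms by blast
  then show ?thesis by (auto simp: span_singleton)
qed

lemma krylov_in_K:
  assumes "\<And>\<theta>. P \<theta> *v e x \<in> K" shows "krylov k x \<in> K"
  unfolding matpow_spectral[OF A_sym]
  by (intro subspace_sum[OF subspace_K] subspace_scale[OF subspace_K] assms)

text \<open>Along a geodesic from \<open>u\<close> to \<open>v\<close> the vectors below have triangular coordinates: the first
  \<open>i + 1\<close> of them from one side, the remaining ones from the other.\<close>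
definition "mixed i k = (if k \<le> i then krylov k u else krylov (d - k) v)"

lemma mixed_zero:
  assumes 0: "(\<Sum>k\<le>d. c k *\<^sub>R mixed i k) = 0"
  shows "\<forall>k\<in>{..d}. c k = 0"
proof -
  have "c j = 0" if "j \<le> d" for j
    using that
  \<comment> \<open>Coefficients are eliminated from \<open>j = i\<close> down to 0 on the side of
    \<open>u\<close>, and from \<open>j = i + 1\<close> up to \<open>d\<close> on the side of
    \<open>v\<close>.\<close>
  proof (induction "if j \<le> i then i - j else j" arbitrary: j rule: less_induct)
    case (less j)
    have "j \<le> gdist E u v" using less.prems gdist_uv by simp
    \<comment> \<open>At this geodesic vertex the vectors from \<open>u\<close> vanish for
      \<open>k < j\<close> and those from \<open>v\<close> for \<open>k > j\<close>; any other index
      with a nonzero value comes earlier in the induction.\<close>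
    then obtain p where p: "gdist E u p = j" "gdist E p v = d - j"
      using gdist_uv by (metis gdist_between)
    have "c k * mixed i k $ p = 0" if k: "k \<le> d" "k \<noteq> j" for k
    proof (cases "mixed i k $ p = 0")
      case False
      have "\<not> k < j" if "k \<le> i"
        using False that krylov_less_gdist[of k u p] p by (auto simp: mixed_def)
      moreover have "\<not> j < k" if "\<not> k \<le> i"
      proof
        assume "j < k"
        then have "d - k < gdist E v p"
          using k(1) p(2) gdist_sym[of v p] by simp
        then show False
          using False that krylov_less_gdist[of "d - k" v p] by (simp add: mixed_def)
      qed
      ultimately have "(if k \<le> i then i - k else k) < (if j \<le> i then i - j else j)"
        using k(2) by (cases "k \<le> i"; cases "j \<le> i"; simp; linarith)
      then have "c k = 0" using less.hyps k(1) by blast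
      then show ?thesis by simp
    qed simp
    then have "(\<Sum>k\<le>d. c k * mixed i k $ p) = (\<Sum>k\<le>d. if k = j then c k * mixed i k $ p else 0)"
      by (intro sum.cong) auto
    moreover have "(\<Sum>k\<le>d. c k * mixed i k $ p) = 0"
      using arg_cong[OF 0, of "\<lambda>y. y $ p"] by simp
    ultimately have "c j * mixed i j $ p = 0"
      using less.prems by simp
    moreover have "mixed i j $ p > 0"
      using krylov_gdist[of u p] krylov_gdist[of v p] p gdist_sym[of v p] by (simp add: mixed_def)
    ultimately show ?case by simp
  qed
  then show ?thesis by simp
qed

lemma inj_mixed: "inj_on (mixed i) {..d}" and independent_mixed: "independent (mixed i ` {..d})"
  using independent_family[of "{..d}" "mixed i"] mixed_zero by blast+

lemma span_mixed:
  assumes "mixed i ` {..d} \<subseteq> V" "dim V \<le> Suc d"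
  shows "V \<subseteq> span (mixed i ` {..d})"
  by (rule card_ge_dim_independent[OF assms(1) independent_mixed])
    (use assms(2) in \<open>simp add: card_image[OF inj_mixed]\<close>)

section \<open>Distance classes weighted by the Perron vector\<close>

abbreviation "\<phi> \<equiv> perron_vec E"

definition "cell i = {w. gdist E u w = i}"

text \<open>The Perron weights absorb the conjugation by \<open>D\<close> in pseudo equitability, so
  that \<open>A\<close> itself can act on these vectors.\<close>

definition "cellvec i = (\<chi> w. if gdist E u w = i then \<phi> $ w else 0)"

lemma cell_nonempty:
  assumes "i \<le> d" obtains w where "gdist E u w = i"
  using gdist_between[of i u v] assms gdist_uv by metis

lemma sum_cellvec_nth: "gdist E u w \<le> n \<Longrightarrow> (\<Sum>i\<le>n. c i *\<^sub>R cellvec i) $ w = c (gdist E u w) * \<phi> $ w"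
  by (simp add: cellvec_def if_distrib cong: if_cong)

lemma gdist_u_le: "gdist E u w \<le> d"
  using gdist_le_ecc[of u w] ecc_u by simp

lemma inj_cellvec: "inj_on cellvec {..d}" and independent_cellvec: "independent (cellvec ` {..d})"
proof -
  have "\<forall>i\<in>{..d}. c i = 0" if "(\<Sum>i\<le>d. c i *\<^sub>R cellvec i) = 0" for c
  proof
    fix i assume "i \<in> {..d}"
    then obtain w where w: "gdist E u w = i" using cell_nonempty by auto
    then have "c i * \<phi> $ w = 0"
      using sum_cellvec_nth[OF gdist_u_le, of c w] that by simp
    then show "c i = 0" using perron_vec(1)[of w] by simp
  qed
  then show "inj_on cellvec {..d}" "independent (cellvec ` {..d})"
    using independent_family[of "{..d}" cellvec] by blast+
qed

lemma A_cellvec: "(A *v cellvec j) $ x = (\<Sum>y\<in>cell j. A $ x $ y * \<phi> $ y)"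
proof -
  have "(A *v cellvec j) $ x = (\<Sum>y\<in>UNIV. if gdist E u y = j then A $ x $ y * \<phi> $ y else 0)"
    unfolding matrix_vector_mult_def cellvec_def by (auto intro!: sum.cong)
  then show ?thesis by (simp add: sum.If_cases cell_def)
qed

lemma distance_partition_u: "distance_partition E u = cell ` {..d}"
  by (auto simp: distance_partition_def ecc_u cell_def)

lemma is_partition_u: "is_partition (distance_partition E u)"
proof -
  have "w \<in> \<Union> (cell ` {..d})" for w using gdist_u_le[of w] by (auto simp: cell_def)
  moreover have "cell i \<noteq> {}" if "i \<le> d" for i
    using cell_nonempty[OF that] by (auto simp: cell_def)
  ultimately show ?thesis
    unfolding is_partition_def distance_partition_u by (auto simp: cell_def)
qed

text \<open>Multiplying the row condition at \<open>x\<close> by \<open>\<phi> $ x\<close> turns the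
  sum over a class into an entry of \<open>A *v cellvec j\<close>. The condition thus says that the
  span of the class vectors is invariant under \<open>A\<close>.\<close>

lemma pseudo_equitable_iff:
  "pseudo_equitable E (distance_partition E u) \<longleftrightarrow>
    (\<forall>j\<le>d. \<exists>\<beta>. \<forall>x. (A *v cellvec j) $ x = \<beta> (gdist E u x) * \<phi> $ x)"
proof -
  define f where "f j x = (A *v cellvec j) $ x / \<phi> $ x" for j x
  have row: "(\<Sum>y\<in>cell j. A $ x $ y * \<phi> $ y / \<phi> $ x) = f j x" for j x
    by (simp add: A_cellvec sum_divide_distrib f_def)
  have "pseudo_equitable E (distance_partition E u) \<longleftrightarrow>
      (\<forall>j\<in>{..d}. \<forall>i\<in>{..d}. \<forall>x\<in>cell i. \<forall>x'\<in>cell i. f j x = f j x')"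
    using is_partition_u unfolding pseudo_equitable_def Let_def distance_partition_u ball_simps(9) row
    by blast
  also have "\<dots> \<longleftrightarrow> (\<forall>j\<le>d. \<forall>x x'. gdist E u x = gdist E u x' \<longrightarrow> f j x = f j x')"
    using gdist_u_le by (fastforce simp: cell_def)
  also have "\<dots> \<longleftrightarrow> (\<forall>j\<le>d. \<forall>x x'. gdist E u x = gdist E u x' \<longrightarrow>
        (A *v cellvec j) $ x / \<phi> $ x = (A *v cellvec j) $ x' / \<phi> $ x')"
    by (simp only: f_def)
  also have "\<dots> \<longleftrightarrow> (\<forall>j\<le>d. \<exists>\<beta>. \<forall>x. (A *v cellvec j) $ x = \<beta> (gdist E u x) * \<phi> $ x)"
  proof (intro all_cong1 imp_cong refl iffI)
    fix j
    assume eq: "\<forall>x x'. gdist E u x = gdist E u x' \<longrightarrow>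
        (A *v cellvec j) $ x / \<phi> $ x = (A *v cellvec j) $ x' / \<phi> $ x'"
    define \<beta> where "\<beta> i = (let x = SOME x. gdist E u x = i in (A *v cellvec j) $ x / \<phi> $ x)" for i
    have "(A *v cellvec j) $ x = \<beta> (gdist E u x) * \<phi> $ x" for x
    proof -
      have "gdist E u (SOME x'. gdist E u x' = gdist E u x) = gdist E u x"
        by (rule someI) (rule refl)
      then have "\<beta> (gdist E u x) = (A *v cellvec j) $ x / \<phi> $ x"
        using eq unfolding \<beta>_def Let_def by blast
      then show ?thesis using perron_vec(1)[of x] by simp
    qed
    then show "\<exists>\<beta>. \<forall>x. (A *v cellvec j) $ x = \<beta> (gdist E u x) * \<phi> $ x" by blast
  next
    fix j
    assume "\<exists>\<beta>. \<forall>x. (A *v cellvec j) $ x = \<beta> (gdist E u x) * \<phi> $ x"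
    then obtain \<beta> where \<beta>: "\<And>x. (A *v cellvec j) $ x = \<beta> (gdist E u x) * \<phi> $ x" by blast
    have "(A *v cellvec j) $ x / \<phi> $ x = \<beta> (gdist E u x)" for x
      using perron_vec(1)[of x] by (simp add: \<beta>)
    then show "\<forall>x x'. gdist E u x = gdist E u x' \<longrightarrow>
        (A *v cellvec j) $ x / \<phi> $ x = (A *v cellvec j) $ x' / \<phi> $ x'" by simp
  qed
  finally show ?thesis .
qed

text \<open>The span \<open>W\<close> of the class vectors is invariant and contains
  \<open>e u\<close>, so by dimension the Krylov vectors of \<open>u\<close> fill it and
  \<open>W\<close> lies in \<open>K\<close>. As \<open>{v}\<close> is a class, \<open>e v\<close> is
  in \<open>K\<close>, whence the projections are parallel; cospectrality and
  \<open>coef_sign\<close> fix the factor.\<close>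

lemma antipodal_spectral:
  assumes anti: "antipodal E u v" and r: "r \<le> d"
  shows "P (th r) *v e v = (- 1) ^ r *\<^sub>R (P (th r) *v e u)"
proof -
  define W where "W = span (cellvec ` {..d})"
  have W: "subspace W" by (simp add: W_def)
  have pe: "pseudo_equitable E (distance_partition E u)" and v: "{v} \<in> distance_partition E u"
    and cosp: "cospectral_vertices E u v"
    using anti unfolding antipodal_def by metis+
  have cellvec_W: "cellvec j \<in> W" if "j \<le> d" for j
    using that unfolding W_def by (intro span_base) auto
  have "A *v cellvec j \<in> W" if "j \<le> d" for j
  proof -
    obtain \<beta> where \<beta>: "\<And>x. (A *v cellvec j) $ x = \<beta> (gdist E u x) * \<phi> $ x"
      using pe \<open>j \<le> d\<close> unfolding pseudo_equitable_iff by blast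
    have "A *v cellvec j = (\<Sum>i\<le>d. \<beta> i *\<^sub>R cellvec i)"
      unfolding vec_eq_iff \<beta> sum_cellvec_nth[OF gdist_u_le] by (intro allI refl)
    then show ?thesis
      by (auto intro!: subspace_sum[OF W] subspace_scale[OF W] cellvec_W)
  qed
  then have "cellvec ` {..d} \<subseteq> {y. A *v y \<in> W}" by auto
  moreover have "subspace {y. A *v y \<in> W}"
    using W by (auto simp: subspace_def matrix_vector_right_distrib matrix_vector_mult_scaleR)
  ultimately have "W \<subseteq> {y. A *v y \<in> W}"
    using span_minimal unfolding W_def by blast
  then have inv: "A *v y \<in> W" if "y \<in> W" for y using that by blast
  have singleton: "e w \<in> W" if "cell i = {w}" "i \<le> d" for w i
  proof -
    have "x \<in> cell i \<longleftrightarrow> x = w" for x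
      unfolding that(1) by (rule singleton_iff)
    then have "gdist E u x = i \<longleftrightarrow> x = w" for x
      by (simp add: cell_def)
    then have "cellvec i = \<phi> $ w *\<^sub>R e w"
      by (simp add: vec_eq_iff basis_vec_def axis_def cellvec_def)
    then have "e w = (1 / \<phi> $ w) *\<^sub>R cellvec i"
      using perron_vec(1)[of w] by simp
    also have "\<dots> \<in> W"
      by (intro subspace_scale[OF W] cellvec_W that(2))
    finally show ?thesis .
  qed
  have "cell 0 = {u}" by (auto simp: cell_def)
  then have eu: "e u \<in> W"
    using singleton[of 0 u] by blast
  have "krylov k u \<in> W" for k
  proof (induction k)
    case (Suc k)
    then show ?case using inv by (simp flip: matrix_vector_mul_assoc)
  qed (simp add: eu)
  \<comment> \<open>For \<open>i = d\<close> all mixed vectors are Krylov vectors of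
    \<open>u\<close>.\<close>
  then have "mixed d ` {..d} \<subseteq> W" by (auto simp: mixed_def)
  moreover have "dim W \<le> Suc d"
    using dim_le_card'[of "cellvec ` {..d}"] card_image_le[of "{..d}" cellvec] by (simp add: W_def)
  ultimately have "W \<subseteq> span (mixed d ` {..d})"
    by (rule span_mixed)
  moreover have "span (mixed d ` {..d}) \<subseteq> K"
    by (rule span_minimal[OF _ subspace_K]) (auto simp: mixed_def intro: krylov_in_K proj_in_K)
  moreover have "e v \<in> W"
    using v singleton unfolding distance_partition_u by (metis atMost_iff imageE)
  ultimately have "e v \<in> K" by blast
  then obtain \<beta> where \<beta>: "P (th r) *v e v = \<beta> *\<^sub>R (P (th r) *v e u)"
    using K_proj by blast
  have ne: "P (th r) *v e u \<noteq> 0"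
    using supp_eig_in[OF r] support_iff by blast
  have "norm (P (th r) *v e u) = norm (P (th r) *v e v)"
    using cosp cospectral_iff by blast
  then have "\<bar>\<beta>\<bar> = 1"
    using ne by (simp add: \<beta>)
  then have sq: "\<beta> = 1 \<or> \<beta> = - 1" by linarith
  have "0 < ((- 1) ^ r * \<beta>) * ((P (th r) *v e u) \<bullet> (P (th r) *v e u))"
    using coef_sign[OF r] by (simp add: \<beta> mult.assoc)
  moreover have "0 < (P (th r) *v e u) \<bullet> (P (th r) *v e u)"
    using ne by simp
  ultimately have "0 < (- 1) ^ r * \<beta>"
    by (rule zero_less_mult_pos2)
  with sq have "\<beta> = (- 1) ^ r"
    by (cases "even r") auto
  then show ?thesis by (simp only: \<beta>)
qed

text \<open>The largest eigenvalue is simple, so the projection of \<open>e u\<close> to its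
  eigenspace is a multiple of the Perron vector, nonzero because
  \<open>\<phi> $ u > 0\<close>.\<close>

lemma perron_in_K: "\<phi> \<in> K"
proof -
  let ?\<rho> = "Max (eigenvalues A)"
  have \<phi>: "P ?\<rho> *v \<phi> = \<phi>"
    by (rule eig_proj_id[OF A_sym]) (simp add: eigenspace_def perron_vec(2))
  obtain c where c: "P ?\<rho> *v e u = c *\<^sub>R \<phi>"
    using perron_simple[OF eig_proj_eigen[OF A_sym]] by blast
  have "\<phi> \<bullet> (P ?\<rho> *v e u) = \<phi> $ u"
    by (simp add: eig_proj_inner[OF A_sym, symmetric] \<phi> inner_e)
  then have "c \<noteq> 0"
    using c perron_vec(1)[of u] by auto
  then have "\<phi> = (1 / c) *\<^sub>R (P ?\<rho> *v e u)"
    by (simp add: c)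
  then show ?thesis
    using subspace_scale[OF subspace_K proj_in_K] by metis
qed

section \<open>From parallel projections to antipodality\<close>

context
  assumes proj_r: "\<And>r. r \<le> d \<Longrightarrow> P (th r) *v e v = (- 1) ^ r *\<^sub>R (P (th r) *v e u)"
    and proj_0: "\<And>\<theta>. \<theta> \<notin> \<Phi> \<Longrightarrow> P \<theta> *v e v = 0"
begin

lemma krylov_v_in_K: "krylov k v \<in> K"
proof (rule krylov_in_K)
  fix \<theta>
  show "P \<theta> *v e v \<in> K"
    by (cases \<theta> rule: supp_eig_cases)
      (simp_all add: proj_0 proj_r subspace_0[OF subspace_K] subspace_scale[OF subspace_K] proj_in_K)
qed

text \<open>For each \<open>i\<close>, the space \<open>K\<close> is the direct sum of vectors supported on the \<open>i\<close>-ball around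
  \<open>u\<close> and vectors supported on the \<open>(d - i - 1)\<close>-ball around \<open>v\<close>. As these balls are disjoint
  and the Perron vector has full support, they cover the graph and both restrictions of
  the Perron vector lie in \<open>K\<close>.\<close>
lemma ball_split:
  shows ballvec_in_K: "(\<chi> w. if gdist E u w \<le> i then \<phi> $ w else 0) \<in> K"
    and gdist_v_le: "i < gdist E u w \<Longrightarrow> gdist E v w + i < d"
proof -
  have "mixed i ` {..d} \<subseteq> K"
    by (auto simp: mixed_def intro: krylov_v_in_K krylov_in_K proj_in_K)
  then have "\<phi> \<in> span (mixed i ` {..d})"
    using span_mixed[OF _ dim_K] perron_in_K by blast
  then obtain c where c: "\<phi> = (\<Sum>k\<le>d. c k *\<^sub>R mixed i k)"
    using span_family[OF _ inj_mixed] by blast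
  have nth: "\<phi> $ w = (\<Sum>k\<le>d. c k * mixed i k $ w)" for w
    by (subst c) simp
  \<comment> \<open>The part of the expansion coming from \<open>u\<close>: it agrees with the
    Perron vector on the ball, where the part from \<open>v\<close> vanishes, and it is zero
    outside.\<close>
  let ?b = "\<Sum>k\<in>{..d} \<inter> {..i}. c k *\<^sub>R krylov k u"
  have near: "?b $ w = \<phi> $ w" if "gdist E u w \<le> i" for w
  proof -
    have "mixed i k $ w = 0" if "k \<le> d" "\<not> k \<le> i" for k
    proof -
      have "d \<le> gdist E u w + gdist E v w"
        using gdist_triangle[of u v w] gdist_sym[of w v] gdist_uv by simp
      then have "d - k < gdist E v w"
        using that \<open>gdist E u w \<le> i\<close> by linarith
      then show ?thesis
        using that krylov_less_gdist by (simp add: mixed_def)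
    qed
    then have "\<phi> $ w = (\<Sum>k\<in>{..d} \<inter> {..i}. c k * mixed i k $ w)"
      unfolding nth by (intro sum.mono_neutral_right) auto
    also have "\<dots> = ?b $ w"
      unfolding sum_component by (rule sum.cong) (auto simp: mixed_def)
    finally show ?thesis by simp
  qed
  have far: "krylov k u $ w = 0" if "k \<le> i" "i < gdist E u w" for k w
    using that by (intro krylov_less_gdist) simp
  have "(\<chi> w. if gdist E u w \<le> i then \<phi> $ w else 0) = ?b"
  proof (rule vec_eq_iff[THEN iffD2, rule_format])
    fix w
    show "(\<chi> w. if gdist E u w \<le> i then \<phi> $ w else 0) $ w = ?b $ w"
      using near[of w] far[of _ w] by (cases "gdist E u w \<le> i") simp_all
  qed
  also have "\<dots> \<in> K"
    by (intro subspace_sum[OF subspace_K] subspace_scale[OF subspace_K] krylov_in_K proj_in_K)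
  finally show "(\<chi> w. if gdist E u w \<le> i then \<phi> $ w else 0) \<in> K" .
  assume w: "i < gdist E u w"
  \<comment> \<open>Outside the ball the positive entry of the Perron vector must come from the side
    of \<open>v\<close>, from some \<open>k > i\<close>, which puts \<open>w\<close> within distance
    \<open>d - k\<close> of \<open>v\<close>.\<close>
  have "\<exists>k\<le>d. mixed i k $ w \<noteq> 0"
  proof (rule ccontr)
    assume "\<not> (\<exists>k\<le>d. mixed i k $ w \<noteq> 0)"
    then have "\<phi> $ w = 0" unfolding nth by (intro sum.neutral) simp
    then show False using perron_vec(1)[of w] by simp
  qed
  then obtain k where k: "k \<le> d" "mixed i k $ w \<noteq> 0" by blast
  then have "i < k"
    using far[of k w] w by (auto simp: mixed_def not_le[symmetric])
  moreover have "\<not> d - k < gdist E v w"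
    using k \<open>i < k\<close> krylov_less_gdist[of "d - k" v w] by (auto simp: mixed_def)
  ultimately show "gdist E v w + i < d" using k(1) by linarith
qed

text \<open>The vertex \<open>w\<close> lies just outside the ball of radius
  \<open>gdist E u w - 1\<close>, so \<open>gdist_v_le\<close> at this radius gives the upper bound;
  the triangle inequality gives the lower one. At \<open>w = u\<close> there is no such
  radius.\<close>

lemma gdist_v: "gdist E v w = d - gdist E u w"
proof (cases "gdist E u w")
  case 0
  then have "w = u" by simp
  then show ?thesis using gdist_uv gdist_sym[of u v] by (simp only: gdist_self diff_zero)
next
  case (Suc i)
  have "gdist E v w + i < d" using Suc by (intro gdist_v_le) simp
  moreover have "d \<le> gdist E u w + gdist E v w"
    using gdist_triangle[of u v w] gdist_sym[of w v] gdist_uv by simp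
  ultimately show ?thesis using Suc by linarith
qed

lemma cellvec_in_K: "cellvec i \<in> K"
proof (cases i)
  case 0
  have "cellvec 0 = (\<chi> w. if gdist E u w \<le> 0 then \<phi> $ w else 0)"
    by (simp add: cellvec_def)
  then show ?thesis by (simp only: 0 ballvec_in_K)
next
  case (Suc j)
  have "cellvec (Suc j) = (\<chi> w. if gdist E u w \<le> Suc j then \<phi> $ w else 0) - (\<chi> w. if gdist E u w \<le> j then \<phi> $ w else 0)"
    by (auto simp: cellvec_def vec_eq_iff)
  then show ?thesis
    by (simp only: Suc subspace_diff[OF subspace_K ballvec_in_K ballvec_in_K])
qed

text \<open>The \<open>d + 1\<close> independent class vectors lie in \<open>K\<close>, whose
  dimension is at most \<open>d + 1\<close>, so they span it, and \<open>K\<close> is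
  invariant.\<close>

lemma pseudo_equitable_u: "pseudo_equitable E (distance_partition E u)"
  unfolding pseudo_equitable_iff
proof (intro allI impI)
  fix j
  have "cellvec ` {..d} \<subseteq> K" using cellvec_in_K by blast
  then have "K \<subseteq> span (cellvec ` {..d})"
    by (rule card_ge_dim_independent[OF _ independent_cellvec]) (use dim_K in \<open>simp add: card_image[OF inj_cellvec]\<close>)
  then have "A *v cellvec j \<in> span (cellvec ` {..d})"
    using K_invariant[OF cellvec_in_K] by blast
  then obtain \<beta> where "A *v cellvec j = (\<Sum>i\<le>d. \<beta> i *\<^sub>R cellvec i)"
    using span_family[OF _ inj_cellvec] by blast
  then have "(A *v cellvec j) $ x = \<beta> (gdist E u x) * \<phi> $ x" for x
    using sum_cellvec_nth[OF gdist_u_le] by simp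
  then show "\<exists>\<beta>. \<forall>x. (A *v cellvec j) $ x = \<beta> (gdist E u x) * \<phi> $ x" by blast
qed

text \<open>By \<open>gdist_v\<close> the class at distance \<open>i\<close> from \<open>u\<close>
  is the class at distance \<open>d - i\<close> from \<open>v\<close>. Factors of modulus one
  preserve the norms of the projections, which gives cospectrality.\<close>

lemma antipodal_if_spectral: "antipodal E u v"
proof -
  have ecc_v: "ecc E v = d"
    unfolding ecc_def
  proof (rule Max_eqI)
    show "d \<in> range (gdist E v)"
      by (rule range_eqI[of _ _ u]) (simp only: gdist_v gdist_self diff_zero)
  qed (auto simp: gdist_v)
  have cell_v: "{w. gdist E v w = i} = {w. gdist E u w = d - i}" if "i \<le> d" for i
    using that gdist_u_le by (auto simp: gdist_v)
  have part: "distance_partition E u = distance_partition E v"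
  proof (intro subset_antisym subsetI)
    fix C assume "C \<in> distance_partition E u"
    then obtain i where "i \<le> d" "C = {w. gdist E u w = i}"
      by (auto simp: distance_partition_def ecc_u)
    then have "d - i \<le> d" "C = {w. gdist E v w = d - i}"
      using cell_v[of "d - i"] by simp_all
    then show "C \<in> distance_partition E v"
      unfolding distance_partition_def ecc_v by blast
  next
    fix C assume "C \<in> distance_partition E v"
    then obtain i where "i \<le> d" "C = {w. gdist E v w = i}"
      by (auto simp: distance_partition_def ecc_v)
    then have "d - i \<le> d" "C = {w. gdist E u w = d - i}"
      using cell_v[of i] by simp_all
    then show "C \<in> distance_partition E u"
      unfolding distance_partition_def ecc_u by blast
  qed
  have singleton: "{x} \<in> distance_partition E x" for x
    unfolding distance_partition_def by (intro CollectI exI[of _ 0]) auto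
  have "norm (P \<theta> *v e u) = norm (P \<theta> *v e v)" for \<theta>
    using proj_0[of \<theta>] proj_r support_iff[of \<theta>] by (cases \<theta> rule: supp_eig_cases) simp_all
  then have "cospectral_vertices E u v"
    by (simp add: cospectral_iff)
  moreover have "gdist E u v = Max {gdist E u w |w. True}"
    using dist_ecc by (simp add: ecc_def full_SetCompr_eq)
  ultimately show ?thesis
    unfolding antipodal_def using pseudo_equitable_u part singleton by metis
qed

end

text \<open>The common phase \<open>z\<close> of \<open>pst_spectral\<close> is eliminated by
  comparing each \<open>r\<close> with \<open>r = 0\<close>.\<close>

lemma pst_iff:
  "pst_at E u v \<tau> \<longleftrightarrow>
    antipodal E u v \<and> (\<forall>r\<le>d. cis (\<tau> * (th 0 - th r)) = (- 1) ^ r)"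
proof
  assume "pst_at E u v \<tau>"
  then obtain z where z: "cmod z = 1" "\<And>r. r \<le> d \<Longrightarrow> cis (\<tau> * th r) = (- 1) ^ r * z"
    and proj: "\<And>r. r \<le> d \<Longrightarrow> P (th r) *v e v = (- 1) ^ r *\<^sub>R (P (th r) *v e u)"
      "\<And>\<theta>. \<theta> \<notin> \<Phi> \<Longrightarrow> P \<theta> *v e v = 0"
    by (rule pst_spectral) blast
  have "cis (\<tau> * (th 0 - th r)) = (- 1) ^ r" if "r \<le> d" for r
  proof -
    have "cis (\<tau> * (th 0 - th r)) = cis (\<tau> * th 0) / cis (\<tau> * th r)"
      by (simp add: cis_divide right_diff_distrib)
    also have "\<dots> = (- 1) ^ r"
      using z(1) z(2)[of 0] z(2)[OF that] by (cases "even r") auto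
    finally show ?thesis .
  qed
  then show "antipodal E u v \<and> (\<forall>r\<le>d. cis (\<tau> * (th 0 - th r)) = (- 1) ^ r)"
    using antipodal_if_spectral[OF proj] by blast
next
  assume rhs: "antipodal E u v \<and> (\<forall>r\<le>d. cis (\<tau> * (th 0 - th r)) = (- 1) ^ r)"
  show "pst_at E u v \<tau>"
  proof (rule pst_if_spectral[of "cis (\<tau> * th 0)"])
    fix r assume r: "r \<le> d"
    have "cis (\<tau> * th 0) = cis (\<tau> * (th 0 - th r)) * cis (\<tau> * th r)"
      by (simp add: cis_mult algebra_simps)
    then show "cis (\<tau> * th r) = (- 1) ^ r * cis (\<tau> * th 0)"
      using rhs r by (cases "even r") auto
    show "P (th r) *v e v = (- 1) ^ r *\<^sub>R (P (th r) *v e u)"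
      using rhs r antipodal_spectral by blast
  qed simp
qed

end

section \<open>Phases and powers of two\<close>

lemma cis_eq_minus_one_power_iff:
  "cis x = (- 1) ^ r \<longleftrightarrow> (\<exists>m::int. x = of_int m * pi \<and> (even m \<longleftrightarrow> even r))"
proof
  assume x: "cis x = (- 1) ^ r"
  then have "sin x = 0"
    by (cases "even r") (auto simp: complex_eq_iff)
  then obtain m :: int where m: "x = of_int m * pi"
    using sin_zero_iff_int2 by blast
  have "cos x = (if even m then 1 else - 1)"
    using cos_npi_int[of m] by (simp add: m mult.commute)
  with x have "even m \<longleftrightarrow> even r"
    by (cases "even r") (auto simp: complex_eq_iff split: if_splits)
  with m show "\<exists>m::int. x = of_int m * pi \<and> (even m \<longleftrightarrow> even r)" by blast
next
  assume "\<exists>m::int. x = of_int m * pi \<and> (even m \<longleftrightarrow> even r)"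
  then obtain m :: int where m: "x = of_int m * pi" "even m \<longleftrightarrow> even r" by blast
  have "cos x = (if even m then 1 else - 1)" "sin x = 0"
    using cos_npi_int[of m] sin_npi_int[of m] by (simp_all add: m(1) mult.commute)
  then show "cis x = (- 1) ^ r"
    using m(2) by (cases "even r") (auto simp: complex_eq_iff)
qed

theorem theorem4p1:
  fixes E :: "'v::finite \<Rightarrow> 'v \<Rightarrow> bool" and u v :: 'v
    and a \<Delta> :: int and b :: "nat \<Rightarrow> int"
  assumes "simple_graph E" and "connected_graph E"
    and "spectrally_extremal E u"
    and "gdist E u v = ecc E u"
    and "\<Delta> \<ge> 0"
    and "\<forall>r \<le> dual_degree E u.
           supp_eig E u r = (real_of_int a + real_of_int (b r) * sqrt (real_of_int \<Delta>)) / 2"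
  shows "(admits_pst E u v \<longleftrightarrow>
            antipodal E u v \<and>
            (\<exists>\<alpha>::int.
               (\<forall>r \<le> dual_degree E u. odd r \<longrightarrow> int (multiplicity 2 (b 0 - b r)) = \<alpha>) \<and>
               (\<forall>r \<le> dual_degree E u. even r \<and> r \<ge> 2 \<longrightarrow> int (multiplicity 2 (b 0 - b r)) > \<alpha>)))
       \<and> (\<forall>\<alpha>::int.
            antipodal E u v \<and>
            (\<forall>r \<le> dual_degree E u. odd r \<longrightarrow> int (multiplicity 2 (b 0 - b r)) = \<alpha>) \<and>
            (\<forall>r \<le> dual_degree E u. even r \<and> r \<ge> 2 \<longrightarrow> int (multiplicity 2 (b 0 - b r)) > \<alpha>)
            \<longrightarrow> (\<forall>k::int. odd k \<longrightarrow>
                   pst_at E u v (real_of_int k * (2 * pi / (2 powr real_of_int \<alpha> * sqrt (real_of_int \<Delta>))))))"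
proof -
  interpret extremal_pair E u v
    using assms(1-4) by unfold_locales
  define c where "c r = b 0 - b r" for r
  define \<delta> where "\<delta> = sqrt (real_of_int \<Delta>)"
  define val where "val \<alpha> \<longleftrightarrow> (\<forall>r \<le> d. odd r \<longrightarrow> int (multiplicity 2 (c r)) = \<alpha>) \<and>
      (\<forall>r \<le> d. even r \<and> r \<ge> 2 \<longrightarrow> int (multiplicity 2 (c r)) > \<alpha>)" for \<alpha>
  have diff: "th 0 - th r = real_of_int (c r) * \<delta> / 2" if "r \<le> d" for r
    using assms(6) that by (simp add: c_def \<delta>_def field_simps)
  have pos: "\<delta> > 0" "c r > 0" if "0 < r" "r \<le> d" for r
  proof -
    have "0 < real_of_int (c r) * \<delta>"
      using supp_eig_strict[OF that] diff[OF that(2)] by simp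
    moreover have "\<delta> \<ge> 0" using assms(5) by (simp add: \<delta>_def)
    ultimately show "\<delta> > 0" "c r > 0" by (auto simp: zero_less_mult_iff)
  qed
  have val_if_pst: "\<exists>\<alpha>. val \<alpha>" if pst: "pst_at E u v \<tau>" for \<tau>
  proof -
    have "\<exists>m::int. \<tau> * (th 0 - th r) = of_int m * pi \<and> (even m \<longleftrightarrow> even r)" if "r \<le> d" for r
      using pst that unfolding pst_iff cis_eq_minus_one_power_iff by blast
    then obtain m :: "nat \<Rightarrow> int"
      where m: "\<And>r. r \<le> d \<Longrightarrow> \<tau> * (th 0 - th r) = of_int (m r) * pi"
        and parity: "\<And>r. r \<le> d \<Longrightarrow> even (m r) \<longleftrightarrow> even r"
      by metis
    \<comment> \<open>Comparing the phase equations for \<open>r\<close> and for 1 eliminates the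
      time: \<open>c r * m 1 = c 1 * m r\<close> with \<open>m 1\<close> odd, so the exponents of
      two in \<open>c r\<close> and \<open>c 1\<close> differ by the one in
      \<open>m r\<close>.\<close>
    have mult: "multiplicity 2 (c r) = multiplicity 2 (c 1) + multiplicity 2 (m r)" "m r \<noteq> 0"
      if r: "0 < r" "r \<le> d" for r
    proof -
      have 1: "(0::nat) < 1" "1 \<le> d" using r by auto
      have "real_of_int (c r) * (\<tau> * (th 0 - th 1)) = real_of_int (c 1) * (\<tau> * (th 0 - th r))"
        unfolding diff[OF r(2)] diff[OF 1(2)] by simp
      then have "(real_of_int (c r) * real_of_int (m 1)) * pi = (real_of_int (c 1) * real_of_int (m r)) * pi"
        unfolding m[OF r(2)] m[OF 1(2)] by (simp only: mult.assoc)
      then have "real_of_int (c r * m 1) = real_of_int (c 1 * m r)" by simp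
      then have eq: "c r * m 1 = c 1 * m r" by (simp only: of_int_eq_iff)
      have odd: "odd (m 1)" using parity[OF 1(2)] by simp
      then have "m 1 \<noteq> 0" by auto
      with eq pos(2)[OF r] show "m r \<noteq> 0" by auto
      have "multiplicity 2 (c r * m 1) = multiplicity 2 (c r)"
        using pos(2)[OF r] odd \<open>m 1 \<noteq> 0\<close>
        by (subst prime_elem_multiplicity_mult_distrib) (auto intro: not_dvd_imp_multiplicity_0)
      moreover have "multiplicity 2 (c 1 * m r) = multiplicity 2 (c 1) + multiplicity 2 (m r)"
        using pos(2)[OF 1] \<open>m r \<noteq> 0\<close> by (subst prime_elem_multiplicity_mult_distrib) auto
      ultimately show "multiplicity 2 (c r) = multiplicity 2 (c 1) + multiplicity 2 (m r)"
        using eq by simp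
    qed
    \<comment> \<open>For \<open>d > 0\<close> the odd index 1 forces this choice of \<alpha>; for
      \<open>d = 0\<close> both conditions are vacuous.\<close>
    have "val (int (multiplicity 2 (c 1)))"
      unfolding val_def
    proof (intro conjI allI impI)
      fix r assume r: "r \<le> d" "odd r"
      then have "0 < r" by (auto intro: gr0I)
      moreover have "multiplicity 2 (m r) = 0"
        using parity r by (intro not_dvd_imp_multiplicity_0) auto
      ultimately show "int (multiplicity 2 (c r)) = int (multiplicity 2 (c 1))"
        using mult(1)[of r] r by simp
    next
      fix r assume r: "r \<le> d" "even r \<and> 2 \<le> r"
      then have "multiplicity 2 (m r) > 0"
        using parity[of r] mult(2)[of r] by (simp add: multiplicity_gt_zero_iff)
      then show "int (multiplicity 2 (c r)) > int (multiplicity 2 (c 1))"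
        using mult(1)[of r] r by simp
    qed
    then show ?thesis by blast
  qed
  \<comment> \<open>For \<open>r > 0\<close> the phase difference at this time is
    \<open>k * pi\<close> times \<open>c r\<close> divided by the power of two; as \<open>k\<close>
    is odd, the parity of that quotient decides the sign.\<close>
  have pst_if_val: "pst_at E u v (real_of_int k * (2 * pi / (2 powr real_of_int \<alpha> * \<delta>)))" (is "pst_at E u v ?\<tau>")
    if anti: "antipodal E u v" and val: "val \<alpha>" and k: "odd k" for \<alpha> k
    unfolding pst_iff
  proof (intro conjI allI impI anti)
    fix r assume r: "r \<le> d"
    show "cis (?\<tau> * (th 0 - th r)) = (- 1) ^ r"
    \<comment> \<open>At \<open>r = 0\<close> the difference vanishes whatever the time is; this
      covers \<open>d = 0\<close>, where \<delta> may be 0.\<close>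
    proof (cases "r = 0")
      case False
      \<comment> \<open>Since \<open>r > 0\<close>, the odd index 1 is available, so the integer
        \<alpha> is this natural number and \<open>powr\<close> becomes an ordinary power.\<close>
      define n where "n = multiplicity 2 (c 1)"
      have 1: "(0::nat) < 1" "1 \<le> d" "0 < r" using r False by auto
      then have \<alpha>: "\<alpha> = int n" using val by (auto simp: val_def n_def)
      have "\<exists>q. c r = 2 ^ n * q \<and> (even q \<longleftrightarrow> even r)"
      proof (cases "even r")
        case True
        then have "n < multiplicity 2 (c r)"
          using val r False \<alpha> by (auto simp: val_def)
        then have "2 ^ Suc n dvd c r" by (intro multiplicity_dvd') simp
        then show ?thesis using True by (auto elim!: dvdE)
      next
        case odd: False
        then have "n = multiplicity 2 (c r)"
          using val r \<alpha> by (auto simp: val_def)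
        moreover obtain q where "c r = 2 ^ multiplicity 2 (c r) * q" "\<not> 2 dvd q"
          using multiplicity_decompose'[of "c r" 2] pos(2)[OF 1(3) r] by auto
        ultimately show ?thesis using odd by metis
      qed
      then obtain q where q: "c r = 2 ^ n * q" "even q \<longleftrightarrow> even r" by blast
      have "2 powr real_of_int \<alpha> = 2 ^ n" by (simp add: \<alpha> powr_realpow)
      then have "?\<tau> * (th 0 - th r) = real_of_int (k * q) * pi"
        unfolding diff[OF r] q(1) using pos(1)[OF 1(3) r] by (simp add: field_simps)
      moreover have "even (k * q) \<longleftrightarrow> even r" using q k by simp
      ultimately show ?thesis unfolding cis_eq_minus_one_power_iff by blast
    qed simp
  qed
  have "admits_pst E u v \<longleftrightarrow> antipodal E u v \<and> (\<exists>\<alpha>. val \<alpha>)"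
  proof
    assume "admits_pst E u v"
    then obtain \<tau> where "pst_at E u v \<tau>" by (auto simp: admits_pst_def)
    then show "antipodal E u v \<and> (\<exists>\<alpha>. val \<alpha>)"
      using val_if_pst pst_iff by blast
  next
    assume "antipodal E u v \<and> (\<exists>\<alpha>. val \<alpha>)"
    then show "admits_pst E u v"
      using pst_if_val[of _ 1] unfolding admits_pst_def by auto
  qed
  moreover have "\<forall>\<alpha>. antipodal E u v \<and> val \<alpha> \<longrightarrow> (\<forall>k. odd k \<longrightarrow>
      pst_at E u v (real_of_int k * (2 * pi / (2 powr real_of_int \<alpha> * \<delta>))))"
    using pst_if_val by blast
  ultimately show ?thesis
    unfolding val_def c_def \<delta>_def by (rule conjI)
qed

end
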